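(* Let $0\le m\le n$ be integers and let $K_m(x,y)$ be the multivariable Christoffel--Darboux kernel associated with the given linear functional. Then $$K_m(x,y)=\sum_{\substack{0\le\lambda_m\le\dots\le\lambda_1\le n-m\\ 0\le\mu_m\le\dots\le\mu_1\le n-m}}\frac{(-1)^{\sum_{i=1}^m(\lambda_i+\mu_i)}}{\prod_{i=1}^n\langle p_{i-1},p_{i-1}\rangle}\;\det_{i\in[n]\setminus S,\;j\in[n]\setminus T}(c_{i+j-2})\;s_\lambda(x)\,s_\mu(y),$$ where the sum is over integer sequences $\lambda,\mu$ as indicated, $s_\lambda(x)=s_\lambda(x_1,\dots,x_m)$ and $s_\mu(y)=s_\mu(y_1,\dots,y_m)$ are Schur polynomials, $$S=\{\lambda_k+m+1-k:\ 1\le k\le m\},\qquad T=\{\mu_k+m+1-k:\ 1\le k\le m\},$$ and $c_k=\int x^k\,d\mu(x)$.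
   Context: Scalars are complex. Let $f\mapsto\int f(x)\,d\mu(x)$ be a linear functional on polynomials in one variable (the symbol $\mu$ in $d\mu$ is unrelated to the partition $\mu$). For $n\ge1$ let $V_n$ be the space of one-variable polynomials of degree at most $n-1$, and assume that the bilinear pairing $\langle f,g\rangle=\int f(x)g(x)\,d\mu(x)$ is non-degenerate on each $V_n$. Let $(p_k)_{k\ge0}$ be the corresponding monic orthogonal polynomials ($\deg p_k=k$). Let $K(x,y)=\sum_{k=0}^{n-1}\frac{p_k(x)p_k(y)}{\langle p_k,p_k\rangle}$ (depending on $n$). For $x=(x_1,\dots,x_m)$ put $\Delta(x)=\prod_{1\le i<j\le m}(x_j-x_i)$. Let $V_n^m$ ($0\le m\le n$) be the space of antisymmetric polynomials in $x_1,\dots,x_m$ of degree at most $n-1$ in each $x_i$. Write $\int f(x)\,d\mu_m(x)=\frac1{m!}\int f(x_1,\dots,x_m)\,d\mu(x_1)\cdots d\mu(x_m)$, where the functional is applied in each variable separately. The kernel $K_m(x,y)$ is defined by requiring that $\Delta(x)\Delta(y)K_m(x,y)$ be the reproducing kernel of $V_n^m$, i.e. the unique element of $V_n^m\otimes V_n^m$ such that $f(x)=\int f(y)\Delta(x)\Delta(y)K_m(x,y)\,d\mu_m(y)$ for all $f\in V_n^m$. Equivalently, $K_m(x,y)=\frac{\det_{1\le i,j\le m}(K(x_i,y_j))}{\Delta(x)\Delta(y)}$, which is a polynomial. Empty products and determinants equal $1$. $[n]=\{1,\dots,n\}$; rows and columns of determinants indexed by subsets of $[n]$ are ordered increasingly.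 *)

theory Defs
  imports Complex_Main "HOL-Library.FuncSet" "HOL-Computational_Algebra.Polynomial"
    "HOL-Combinatorics.Permutations" "Jordan_Normal_Form.Determinant"
begin

text \<open>
  Points are functions \<open>x :: nat \<Rightarrow> complex\<close>, of which only \<open>x 1, \<dots>, x m\<close> matter. Polynomials in
  \<open>m\<close> variables are represented by polynomial functions, which loses nothing over the infinite
  field of complex numbers.
\<close>

definition nondegenerate_functional :: "(complex poly \<Rightarrow> complex) \<Rightarrow> bool" where
  "nondegenerate_functional L \<longleftrightarrow>
     (\<forall>n\<ge>1. \<forall>f. degree f \<le> n - 1 \<longrightarrow> (\<forall>g. degree g \<le> n - 1 \<longrightarrow> L (f * g) = 0) \<longrightarrow> f = 0)"

definition monic_orthogonal :: "(complex poly \<Rightarrow> complex) \<Rightarrow> (nat \<Rightarrow> complex poly) \<Rightarrow> bool" where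
  "monic_orthogonal L p \<longleftrightarrow>
     (\<forall>k. degree (p k) = k \<and> lead_coeff (p k) = 1) \<and> (\<forall>j k. j \<noteq> k \<longrightarrow> L (p j * p k) = 0)"

definition mono_val :: "nat \<Rightarrow> (nat \<Rightarrow> nat) \<Rightarrow> (nat \<Rightarrow> complex) \<Rightarrow> complex" where
  "mono_val m \<alpha> x = (\<Prod>i=1..m. x i ^ \<alpha> i)"

text \<open>The bound is strict, so that degree at most \<open>n - 1\<close> is also correct for \<open>n = 0\<close>.\<close>

definition mpoly_below :: "nat \<Rightarrow> nat \<Rightarrow> ((nat \<Rightarrow> complex) \<Rightarrow> complex) \<Rightarrow> bool" where
  "mpoly_below n m f \<longleftrightarrow>
     (\<exists>a. \<forall>x. f x = (\<Sum>\<alpha>\<in>{1..m} \<rightarrow>\<^sub>E {..<n}. a \<alpha> * mono_val m \<alpha> x))"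

definition is_mpoly :: "nat \<Rightarrow> ((nat \<Rightarrow> complex) \<Rightarrow> complex) \<Rightarrow> bool" where
  "is_mpoly m f \<longleftrightarrow> (\<exists>n. mpoly_below n m f)"

definition is_mpoly2 :: "nat \<Rightarrow> ((nat \<Rightarrow> complex) \<Rightarrow> (nat \<Rightarrow> complex) \<Rightarrow> complex) \<Rightarrow> bool" where
  "is_mpoly2 m F \<longleftrightarrow>
     (\<exists>n a. \<forall>x y. F x y = (\<Sum>\<alpha>\<in>{1..m} \<rightarrow>\<^sub>E {..<n}. \<Sum>\<beta>\<in>{1..m} \<rightarrow>\<^sub>E {..<n}.
        a \<alpha> \<beta> * mono_val m \<alpha> x * mono_val m \<beta> y))"

definition antisym_space :: "nat \<Rightarrow> nat \<Rightarrow> ((nat \<Rightarrow> complex) \<Rightarrow> complex) set" where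
  "antisym_space n m = {f. mpoly_below n m f \<and>
     (\<forall>\<pi> x. \<pi> permutes {1..m} \<longrightarrow> f (x \<circ> \<pi>) = of_int (sign \<pi>) * f x)}"

definition antisym_tensor ::
    "nat \<Rightarrow> nat \<Rightarrow> ((nat \<Rightarrow> complex) \<Rightarrow> (nat \<Rightarrow> complex) \<Rightarrow> complex) set" where
  "antisym_tensor n m = {G. \<exists>(N::nat) f g.
     (\<forall>k<N. f k \<in> antisym_space n m \<and> g k \<in> antisym_space n m) \<and>
     (\<forall>x y. G x y = (\<Sum>k<N. f k x * g k y))}"

definition vandermonde :: "nat \<Rightarrow> (nat \<Rightarrow> complex) \<Rightarrow> complex" where
  "vandermonde m x = (\<Prod>j=1..m. \<Prod>i=1..<j. (x j - x i))"

definition apply_in_var ::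
    "(complex poly \<Rightarrow> complex) \<Rightarrow> nat \<Rightarrow> ((nat \<Rightarrow> complex) \<Rightarrow> complex) \<Rightarrow> (nat \<Rightarrow> complex) \<Rightarrow> complex" where
  "apply_in_var L i f x = L (THE q. \<forall>t. poly q t = f (x(i := t)))"

fun apply_in_vars ::
    "(complex poly \<Rightarrow> complex) \<Rightarrow> nat \<Rightarrow> ((nat \<Rightarrow> complex) \<Rightarrow> complex) \<Rightarrow> (nat \<Rightarrow> complex) \<Rightarrow> complex" where
  "apply_in_vars L 0 f = f"
| "apply_in_vars L (Suc k) f = apply_in_vars L k (apply_in_var L (Suc k) f)"

text \<open>
  For a polynomial \<open>f\<close> in \<open>m\<close> variables, \<open>apply_in_vars L m f\<close> is constant, hence the evaluation
  at an arbitrary point.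
\<close>

definition multi_functional ::
    "(complex poly \<Rightarrow> complex) \<Rightarrow> nat \<Rightarrow> ((nat \<Rightarrow> complex) \<Rightarrow> complex) \<Rightarrow> complex" where
  "multi_functional L m f = apply_in_vars L m f (\<lambda>_. 0) / fact m"

definition reproducing_kernel ::
    "(complex poly \<Rightarrow> complex) \<Rightarrow> nat \<Rightarrow> nat \<Rightarrow>
     ((nat \<Rightarrow> complex) \<Rightarrow> (nat \<Rightarrow> complex) \<Rightarrow> complex) \<Rightarrow> bool" where
  "reproducing_kernel L n m G \<longleftrightarrow> G \<in> antisym_tensor n m \<and>
     (\<forall>f\<in>antisym_space n m. \<forall>x. f x = multi_functional L m (\<lambda>y. f y * G x y))"

text \<open>
  Requiring \<open>K\<close> to be polynomial fixes its values at points with coinciding coordinates, where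
  the Vandermonde factors vanish.
\<close>

definition CD_kernel ::
    "(complex poly \<Rightarrow> complex) \<Rightarrow> nat \<Rightarrow> nat \<Rightarrow> (nat \<Rightarrow> complex) \<Rightarrow> (nat \<Rightarrow> complex) \<Rightarrow> complex" where
  "CD_kernel L n m = (THE K. is_mpoly2 m K \<and>
     reproducing_kernel L n m (\<lambda>x y. vandermonde m x * vandermonde m y * K x y))"

definition det_on :: "nat set \<Rightarrow> nat set \<Rightarrow> (nat \<Rightarrow> nat \<Rightarrow> complex) \<Rightarrow> complex" where
  "det_on A B a = det (mat (card A) (card B)
     (\<lambda>(i, j). a (sorted_list_of_set A ! i) (sorted_list_of_set B ! j)))"

definition box_partitions :: "nat \<Rightarrow> nat \<Rightarrow> (nat \<Rightarrow> nat) set" where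
  "box_partitions m r = {lam \<in> {1..m} \<rightarrow>\<^sub>E {0..r}. \<forall>i\<in>{1..m}. \<forall>j\<in>{1..m}. i \<le> j \<longrightarrow> lam j \<le> lam i}"

text \<open>
  The Schur polynomial is the bialternant quotient, taken in the polynomial ring. Its denominator
  \<open>det (x i ^ (m - j))\<close> is the product of \<open>x i - x j\<close> over \<open>i < j\<close>, which differs from the
  convention of \<^const>\<open>vandermonde\<close> by a sign.
\<close>

definition schur :: "nat \<Rightarrow> (nat \<Rightarrow> nat) \<Rightarrow> (nat \<Rightarrow> complex) \<Rightarrow> complex" where
  "schur m lam = (THE s. is_mpoly m s \<and>
     (\<forall>x. s x * det_on {1..m} {1..m} (\<lambda>i j. x i ^ (m - j)) =
          det_on {1..m} {1..m} (\<lambda>i j. x i ^ (lam j + m - j))))"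

definition index_set :: "nat \<Rightarrow> (nat \<Rightarrow> nat) \<Rightarrow> nat set" where
  "index_set m lam = {lam k + m + 1 - k | k. 1 \<le> k \<and> k \<le> m}"

definition moment :: "(complex poly \<Rightarrow> complex) \<Rightarrow> nat \<Rightarrow> complex" where
  "moment L k = L (monom 1 k)"

end

theory Submission
  imports Defs
begin

text \<open>
  Let \<open>H = (c\<^bsub>i+j-2\<^esub>)\<close> be the \<open>n \<times> n\<close> Hankel matrix of the moments. Non-degeneracy of the pairing
  on polynomials of degree below \<open>n\<close> says that \<open>H\<close> is invertible; put \<open>B = H\<inverse>\<close>. The one-variable
  kernel is \<open>K(u, v) = \<Sum> B\<^bsub>ab\<^esub> u\<^bsup>a-1\<^esup> v\<^bsup>b-1\<^esup>\<close>, because \<open>B H = 1\<close> is exactly the reproducing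
  property on monomials. The orthogonal polynomials enter only through the determinant: their
  coefficient matrix is unitriangular and turns \<open>H\<close> into the diagonal matrix of the norms, so \<open>det H\<close>
  is the product of the norms (\<open>det_hankel\<close>).

  In \<open>m\<close> variables, \<open>det K(x\<^sub>i, y\<^sub>j)\<close> reproduces antisymmetric polynomials: each term of the Leibniz
  expansion reproduces in every variable separately and, by antisymmetry, gives the same value, which
  the factor \<open>1/m!\<close> averages (\<open>det_kernel_reproduces\<close>). Two reproducing kernels coincide by evaluating
  the pairing of one with the other in two ways (\<open>reproducing_kernel_swap\<close>), and a polynomial is
  determined by its product with the Vandermonde factors since these are non-zero on a dense set
  (\<open>is_mpoly2_vandermonde_cancel\<close>). Hence it suffices to show that the Vandermonde factors times the
  right-hand side equal \<open>det K(x\<^sub>i, y\<^sub>j)\<close>.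

  The Cauchy--Binet formula, applied once to the rows and once to the columns, expands this
  determinant over pairs of \<open>m\<close>-subsets \<open>S, T\<close> of \<open>{1..n}\<close>: the coefficient of the product of the
  alternants \<open>det(x\<^sub>i\<^bsup>s-1\<^esup>)\<close> and \<open>det(y\<^sub>j\<^bsup>t-1\<^esup>)\<close> is the minor of \<open>B\<close> with rows \<open>S\<close> and columns \<open>T\<close>
  (\<open>det_kernel_expansion\<close>). By Jacobi's theorem on complementary minors
  (\<open>jacobi_complementary_minor\<close>) that minor is, up to sign and the factor \<open>1 / det H\<close>, the minor of
  \<open>H\<close> on the complements of \<open>S\<close> and \<open>T\<close>. Finally \<open>S\<close> corresponds to a partition in the
  \<open>m \<times> (n - m)\<close> box, and its alternant is the Vandermonde product times the Schur polynomial, up to a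
  sign that occurs for \<open>x\<close> and for \<open>y\<close> and so cancels (\<open>vandermonde_schur_alternant\<close>).

  The subsets are encoded as strictly decreasing functions from \<open>{1..m}\<close> to \<open>{1..n}\<close>, because the
  shifted parts \<open>lam k + m + 1 - k\<close> of a partition come in decreasing order.
\<close>

(* The intervals below start at 1, and rewriting 1 to Suc 0 would keep facts about them from matching. *)
declare One_nat_def [simp del]

section \<open>Determinants indexed by an interval\<close>

lemma nth_sorted_list_of_interval: "i < m \<Longrightarrow> sorted_list_of_set {1..m} ! i = Suc i"
  by (simp add: atLeastLessThanSuc_atLeastAtMost[symmetric] One_nat_def del: upt_Suc)

lemma det_on_interval: "det_on {1..m} {1..m} a = det (mat m m (\<lambda>(i, j). a (Suc i) (Suc j)))"
  unfolding det_on_def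
  by (intro arg_cong[of _ _ det] eq_matI) (simp_all add: nth_sorted_list_of_interval)

text \<open>
  The Leibniz sum over permutations of \<open>{1..m}\<close> rather than \<open>{0..<m}\<close>, matching the index sets
  of the antisymmetry condition.
\<close>

lemma det_on_leibniz:
  "det_on {1..m} {1..m} a = (\<Sum>\<pi> | \<pi> permutes {1..m}. of_int (sign \<pi>) * (\<Prod>i=1..m. a i (\<pi> i)))"
proof -
  let ?up = "map_permutation {0..<m} Suc" and ?down = "map_permutation {1..m} (\<lambda>k. k - 1)"
  have bu: "bij_betw Suc {0..<m} {1..m}" and bd: "bij_betw (\<lambda>k. k - 1) {1..m} {0..<m}"
    by (rule bij_betwI[of _ _ _ "\<lambda>k. k - 1"], auto, rule bij_betwI[of _ _ _ Suc], auto)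
  have "det_on {1..m} {1..m} a = det (mat m m (\<lambda>(i, j). a (Suc i) (Suc j)))"
    by (rule det_on_interval)
  also have "\<dots> = (\<Sum>p | p permutes {0..<m}. of_int (sign p) * (\<Prod>i=0..<m. a (Suc i) (Suc (p i))))"
    by (subst det_def'[of _ m], simp, intro sum.cong refl arg_cong2[of _ _ _ _ "(*)"] prod.cong)
       (simp_all add: permutes_nat_less)
  also have "\<dots> = (\<Sum>\<pi> | \<pi> permutes {1..m}. of_int (sign \<pi>) * (\<Prod>i=1..m. a i (\<pi> i)))"
  proof (rule sum.reindex_bij_witness[of _ ?down ?up])
    fix p assume p: "p \<in> {p. p permutes {0..<m}}"
    show "?up p \<in> {\<pi>. \<pi> permutes {1..m}}"
      using map_permutation_permutes[OF bu] p by simp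
    show "?down (?up p) = p"
      using map_permutation_compose_inv[OF bu] p by simp
    have "(\<Prod>i=1..m. a i (?up p i)) = (\<Prod>i=0..<m. a (Suc i) (?up p (Suc i)))"
      by (rule prod.reindex_bij_betw[OF bu, symmetric])
    also have "\<dots> = (\<Prod>i=0..<m. a (Suc i) (Suc (p i)))"
      by (intro prod.cong refl) (simp add: map_permutation_apply)
    finally show "of_int (sign (?up p)) * (\<Prod>i=1..m. a i (?up p i))
        = of_int (sign p) * (\<Prod>i=0..<m. a (Suc i) (Suc (p i)))"
      using p sign_map_permutation[of Suc "{0..<m}" p] by simp
  next
    fix \<pi> assume \<pi>: "\<pi> \<in> {\<pi>. \<pi> permutes {1..m}}"
    show "?down \<pi> \<in> {p. p permutes {0..<m}}"
      using map_permutation_permutes[OF bd] \<pi> by simp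
    show "?up (?down \<pi>) = \<pi>"
      using map_permutation_compose_inv[OF bd] \<pi> by simp
  qed
  finally show ?thesis .
qed

lemma det_on_cong:
  assumes "\<And>i j. i \<in> A \<Longrightarrow> j \<in> B \<Longrightarrow> a i j = b i j" "finite A" "finite B"
  shows "det_on A B a = det_on A B b"
proof -
  have "sorted_list_of_set A ! i \<in> A" if "i < card A" for i
    using that assms(2) by (metis nth_mem set_sorted_list_of_set length_sorted_list_of_set)
  moreover have "sorted_list_of_set B ! i \<in> B" if "i < card B" for i
    using that assms(3) by (metis nth_mem set_sorted_list_of_set length_sorted_list_of_set)
  ultimately show ?thesis
    unfolding det_on_def by (intro arg_cong[of _ _ det] eq_matI) (auto simp: assms(1))
qed

lemma det_on_transpose:
  assumes "card A = card B"
  shows "det_on A B (\<lambda>i j. a j i) = det_on B A a"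
proof -
  let ?M = "mat (card B) (card A) (\<lambda>(i, j). a (sorted_list_of_set B ! i) (sorted_list_of_set A ! j))"
  have "mat (card A) (card B) (\<lambda>(i, j). a (sorted_list_of_set B ! j) (sorted_list_of_set A ! i))
      = transpose_mat ?M"
    by (intro eq_matI) auto
  then show ?thesis
    unfolding det_on_def using det_transpose[of ?M "card A"] assms by simp
qed

lemma det_on_permute_rows:
  assumes "\<rho> permutes {1..m}"
  shows "det_on {1..m} {1..m} (\<lambda>i j. a (\<rho> i) j) = of_int (sign \<rho>) * det_on {1..m} {1..m} a"
proof -
  have inv: "(Hilbert_Choice.inv \<rho>) permutes {1..m}" using assms by (rule permutes_inv)
  have "det_on {1..m} {1..m} a
      = (\<Sum>\<pi> | \<pi> permutes {1..m}. of_int (sign (\<pi> \<circ> Hilbert_Choice.inv \<rho>)) * (\<Prod>i=1..m. a i ((\<pi> \<circ> Hilbert_Choice.inv \<rho>) i)))"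
    unfolding det_on_leibniz
    by (rule sum.reindex_bij_betw[symmetric], rule bij_betwI[of _ _ _ "\<lambda>\<pi>. \<pi> \<circ> \<rho>"])
       (use permutes_compose[OF inv] permutes_compose[OF assms] permutes_inv_o[OF assms]
         in \<open>auto simp: o_assoc[symmetric]\<close>)
  also have "\<dots> = (\<Sum>\<pi> | \<pi> permutes {1..m}. of_int (sign \<rho>) *
      (of_int (sign \<pi>) * (\<Prod>i=1..m. a (\<rho> i) (\<pi> i))))"
  proof (rule sum.cong[OF refl])
    fix \<pi> assume "\<pi> \<in> {\<pi>. \<pi> permutes {1..m}}"
    then have p: "\<pi> permutes {1..m}" by simp
    have "(\<Prod>i=1..m. a i ((\<pi> \<circ> Hilbert_Choice.inv \<rho>) i)) = (\<Prod>i=1..m. a (\<rho> i) ((\<pi> \<circ> Hilbert_Choice.inv \<rho>) (\<rho> i)))"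
      by (rule prod.reindex_bij_betw[OF permutes_imp_bij[OF assms], symmetric])
    then have "(\<Prod>i=1..m. a i ((\<pi> \<circ> Hilbert_Choice.inv \<rho>) i)) = (\<Prod>i=1..m. a (\<rho> i) (\<pi> i))"
      by (simp add: permutes_inverses[OF assms])
    moreover have "sign (\<pi> \<circ> Hilbert_Choice.inv \<rho>) = sign \<rho> * sign \<pi>"
      using p assms inv finite_atLeastAtMost permutation_permutes sign_compose sign_inverse mult.commute
      by metis
    ultimately show "of_int (sign (\<pi> \<circ> Hilbert_Choice.inv \<rho>)) * (\<Prod>i=1..m. a i ((\<pi> \<circ> Hilbert_Choice.inv \<rho>) i)) =
        of_int (sign \<rho>) * (of_int (sign \<pi>) * (\<Prod>i=1..m. a (\<rho> i) (\<pi> i)))"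
      by simp
  qed
  finally have e: "det_on {1..m} {1..m} a = of_int (sign \<rho>) * det_on {1..m} {1..m} (\<lambda>i j. a (\<rho> i) j)"
    by (simp add: det_on_leibniz sum_distrib_left)
  have "sign \<rho> * sign \<rho> = 1" by (simp add: sign_idempotent)
  then have "of_int (sign \<rho>) * of_int (sign \<rho>) = (1::complex)"
    by (metis of_int_1 of_int_mult)
  then show ?thesis by (simp add: e mult.assoc[symmetric])
qed

lemma det_on_equal_rows:
  assumes "i \<in> {1..m}" "j \<in> {1..m}" "i \<noteq> j" "\<And>k. a i k = a j k"
  shows "det_on {1..m} {1..m} a = 0"
proof -
  have t: "Transposition.transpose i j permutes {1..m}"
    using assms by (intro permutes_swap_id) auto
  have "(\<lambda>k l. a (Transposition.transpose i j k) l) = a"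
    using assms(4) by (auto simp: fun_eq_iff Transposition.transpose_def)
  then have "det_on {1..m} {1..m} a = - det_on {1..m} {1..m} a"
    using det_on_permute_rows[OF t, of a] assms(3) by (simp add: sign_swap_id)
  then show ?thesis by simp
qed

lemma det_on_matrix_mult:
  "det_on {1..m} {1..m} (\<lambda>i j. \<Sum>k=1..m. P i k * Q k j)
   = det_on {1..m} {1..m} P * det_on {1..m} {1..m} Q"
proof -
  let ?M = "\<lambda>a. mat m m (\<lambda>(i, j). a (Suc i) (Suc j)) :: complex mat"
  have "?M (\<lambda>i j. \<Sum>k=1..m. P i k * Q k j) = ?M P * ?M Q"
    by (intro eq_matI) (auto simp: scalar_prod_def One_nat_def sum.atLeast1_atMost_eq lessThan_atLeast0)
  then show ?thesis unfolding det_on_interval by (simp add: det_mult[of _ m])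
qed

lemma det_on_lower_triangular:
  assumes "\<And>i j. i \<in> {1..m} \<Longrightarrow> j \<in> {1..m} \<Longrightarrow> i < j \<Longrightarrow> a i j = 0"
  shows "det_on {1..m} {1..m} a = (\<Prod>i=1..m. a i i)"
proof -
  let ?M = "mat m m (\<lambda>(i, j). a (Suc i) (Suc j))"
  have "det_on {1..m} {1..m} a = det ?M"
    by (rule det_on_interval)
  also have "\<dots> = prod_list (diag_mat ?M)"
    by (rule det_lower_triangular[of m]) (auto intro!: assms)
  also have "\<dots> = (\<Prod>i=0..<m. a (Suc i) (Suc i))"
    by (simp add: diag_mat_def prod.list_conv_set_nth cong: prod.cong_simp)
  also have "\<dots> = (\<Prod>i=1..m. a i i)"
    by (simp add: One_nat_def prod.atLeast1_atMost_eq lessThan_atLeast0)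
  finally show ?thesis .
qed

section \<open>The Cauchy--Binet formula\<close>

definition dec_functions :: "nat \<Rightarrow> nat \<Rightarrow> (nat \<Rightarrow> nat) set" where
  "dec_functions m n = {f \<in> {1..m} \<rightarrow>\<^sub>E {1..n}. \<forall>i\<in>{1..m}. \<forall>j\<in>{1..m}. i < j \<longrightarrow> f j < f i}"

lemma dec_functions_inj_on: "f \<in> dec_functions m n \<Longrightarrow> inj_on f {1..m}"
  unfolding dec_functions_def inj_on_def by (auto, metis linorder_neqE_nat less_irrefl atLeastAtMost_iff)

lemma dec_list_strict_sorted:
  assumes "f \<in> dec_functions m n"
  shows "sorted_wrt (>) (map f [1..<Suc m])"
  using assms unfolding dec_functions_def
  by (auto simp: sorted_wrt_iff_nth_less nth_append simp del: upt_Suc)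

lemma dec_functions_unique:
  assumes f: "f \<in> dec_functions m n" and g: "g \<in> dec_functions m n" and im: "f ` {1..m} = g ` {1..m}"
  shows "f = g"
proof -
  have s: "set [1..<Suc m] = {1..m}" by (simp only: set_upt atLeastLessThanSuc_atLeastAtMost)
  have "rev (map f [1..<Suc m]) = rev (map g [1..<Suc m])"
    using dec_list_strict_sorted[OF f] dec_list_strict_sorted[OF g] im
    by (intro strict_sorted_equal) (simp_all add: sorted_wrt_rev s del: upt_Suc set_upt)
  then have "\<forall>k\<in>{1..m}. f k = g k" by (simp add: s del: upt_Suc set_upt)
  then show ?thesis
    using f g unfolding dec_functions_def by (auto intro!: PiE_ext[of f "{1..m}" "\<lambda>_. {1..n}"])
qed

lemma dec_functions_exists:
  assumes "F \<subseteq> {1..n}" "card F = m"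
  obtains f where "f \<in> dec_functions m n" "f ` {1..m} = F"
proof -
  have fin: "finite F" using assms(1) by (rule finite_subset) simp
  define l where "l = rev (sorted_list_of_set F)"
  have len: "length l = m" and sl: "set l = F" and dec: "sorted_wrt (>) l"
    using assms fin by (auto simp: l_def sorted_wrt_rev)
  define f where "f = (\<lambda>k\<in>{1..m}. l ! (k - 1))"
  have im: "f ` {1..m} = F"
  proof -
    have "f ` {1..m} = (\<lambda>k. l ! k) ` (\<lambda>k. k - 1) ` {1..m}"
      unfolding image_image f_def by (rule image_cong) auto
    also have "(\<lambda>k. k - 1) ` {1..m} = {0..<m}"
      by (auto simp: image_iff intro!: bexI[of _ "Suc _"])
    also have "(\<lambda>k. l ! k) ` {0..<m} = set l"
      using len by (auto simp: set_conv_nth)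
    finally show ?thesis using sl by simp
  qed
  have "f j < f i" if "i \<in> {1..m}" "j \<in> {1..m}" "i < j" for i j
    using that dec len unfolding f_def sorted_wrt_iff_nth_less by auto
  moreover have "f \<in> {1..m} \<rightarrow>\<^sub>E {1..n}"
    using im assms(1) by (intro PiE_I) (blast, auto simp: f_def)
  ultimately show ?thesis
    using im by (intro that[of f]) (auto simp: dec_functions_def)
qed

text \<open>
  An injection into \<open>{1..n}\<close> is determined by its image, listed decreasingly, and by the order in
  which the values are taken.
\<close>

lemma sum_over_injections:
  fixes F :: "(nat \<Rightarrow> nat) \<Rightarrow> complex"
  shows "(\<Sum>f | f \<in> {1..m} \<rightarrow>\<^sub>E {1..n} \<and> inj_on f {1..m}. F f)
     = (\<Sum>h\<in>dec_functions m n. \<Sum>\<pi> | \<pi> permutes {1..m}. F (h \<circ> \<pi>))"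
proof -
  let ?P = "{\<pi>. \<pi> permutes {1..m}}" and ?I = "{f \<in> {1..m} \<rightarrow>\<^sub>E {1..n}. inj_on f {1..m}}"
  have bij: "bij_betw (\<lambda>(h, \<pi>). h \<circ> \<pi>) (dec_functions m n \<times> ?P) ?I"
    unfolding bij_betw_def
  proof (intro conjI)
    show "inj_on (\<lambda>(h, \<pi>). h \<circ> \<pi>) (dec_functions m n \<times> ?P)"
    proof (rule inj_onI, clarify)
      fix h \<pi> h' \<pi>'
      assume h: "h \<in> dec_functions m n" "h' \<in> dec_functions m n"
        and \<pi>: "\<pi> permutes {1..m}" "\<pi>' permutes {1..m}" and eq: "h \<circ> \<pi> = h' \<circ> \<pi>'"
      have im: "h ` {1..m} = (h \<circ> \<pi>) ` {1..m}" "h' ` {1..m} = (h' \<circ> \<pi>') ` {1..m}"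
        using permutes_image[OF \<pi>(1)] permutes_image[OF \<pi>(2)] by (metis image_comp)+
      have "h ` {1..m} = h' ` {1..m}"
        by (subst im(1), subst im(2), subst eq, rule refl)
      then have hh: "h = h'" by (rule dec_functions_unique[OF h])
      have "\<pi> k = \<pi>' k" for k
      proof (cases "k \<in> {1..m}")
        case True
        then have "\<pi> k \<in> {1..m}" "\<pi>' k \<in> {1..m}" by (simp_all only: permutes_in_image[OF \<pi>(1)] permutes_in_image[OF \<pi>(2)])
        moreover have "h (\<pi> k) = h (\<pi>' k)" using eq hh by (metis comp_apply)
        ultimately show ?thesis using dec_functions_inj_on[OF h(1)] by (meson inj_onD)
      next
        case False
        then show ?thesis using \<pi> by (simp add: permutes_not_in)
      qed
      then show "h = h' \<and> \<pi> = \<pi>'" using hh by auto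
    qed
    show "(\<lambda>(h, \<pi>). h \<circ> \<pi>) ` (dec_functions m n \<times> ?P) = ?I"
    proof (intro equalityI subsetI)
      fix f assume "f \<in> (\<lambda>(h, \<pi>). h \<circ> \<pi>) ` (dec_functions m n \<times> ?P)"
      then obtain h \<pi> where h: "h \<in> dec_functions m n" and \<pi>: "\<pi> permutes {1..m}" and f: "f = h \<circ> \<pi>"
        by auto
      have "inj_on f {1..m}"
        unfolding f using dec_functions_inj_on[OF h] \<pi>
        by (intro comp_inj_on) (auto simp: permutes_inj_on permutes_image)
      moreover have hE: "h \<in> {1..m} \<rightarrow>\<^sub>E {1..n}"
        using h by (simp add: dec_functions_def)
      have "f \<in> {1..m} \<rightarrow>\<^sub>E {1..n}"
      proof (rule PiE_I)
        fix k assume "k \<in> {1..m}"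
        then have "\<pi> k \<in> {1..m}" by (simp only: permutes_in_image[OF \<pi>])
        then show "f k \<in> {1..n}" unfolding f comp_apply by (rule PiE_mem[OF hE])
      next
        fix k assume "k \<notin> {1..m}"
        then show "f k = undefined"
          unfolding f comp_apply permutes_not_in[OF \<pi> \<open>k \<notin> {1..m}\<close>] by (rule PiE_arb[OF hE])
      qed
      ultimately show "f \<in> ?I" by simp
    next
      fix f assume "f \<in> ?I"
      then have fE: "f \<in> {1..m} \<rightarrow>\<^sub>E {1..n}" and inj: "inj_on f {1..m}" by auto
      have "f ` {1..m} \<subseteq> {1..n}" "card (f ` {1..m}) = m"
        using fE inj by (auto simp: card_image)
      then obtain h where h: "h \<in> dec_functions m n" and im: "h ` {1..m} = f ` {1..m}"
        by (rule dec_functions_exists)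
      define \<pi> where "\<pi> k = (if k \<in> {1..m} then inv_into {1..m} h (f k) else k)" for k
      have hb: "bij_betw h {1..m} (f ` {1..m})"
        using dec_functions_inj_on[OF h] im by (simp add: bij_betw_def)
      \<comment> \<open>The permutation is extended by the identity outside \<open>{1..m}\<close>.\<close>
      have "bij_betw (inv_into {1..m} h \<circ> f) {1..m} {1..m}"
        using bij_betw_inv_into[OF hb] inj by (intro bij_betw_trans[of f _ "f ` {1..m}"]) (auto simp: bij_betw_def)
      then have "bij_betw \<pi> {1..m} {1..m}"
        by (rule bij_betw_cong[THEN iffD1, rotated]) (simp add: \<pi>_def)
      then have \<pi>: "\<pi> permutes {1..m}"
        by (rule bij_imp_permutes) (auto simp: \<pi>_def)
      have "f k = (h \<circ> \<pi>) k" for k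
      proof (cases "k \<in> {1..m}")
        case True
        then show ?thesis using im by (simp add: \<pi>_def f_inv_into_f)
      next
        case False
        have hE: "h \<in> {1..m} \<rightarrow>\<^sub>E {1..n}" using h by (simp add: dec_functions_def)
        have "\<pi> k = k" using False by (auto simp: \<pi>_def)
        then show ?thesis
          using PiE_arb[OF fE False] PiE_arb[OF hE False] by simp
      qed
      then show "f \<in> (\<lambda>(h, \<pi>). h \<circ> \<pi>) ` (dec_functions m n \<times> ?P)"
        using h \<pi> by (intro image_eqI[of _ _ "(h, \<pi>)"]) auto
    qed
  qed
  have "(\<Sum>f\<in>?I. F f) = (\<Sum>(h, \<pi>)\<in>dec_functions m n \<times> ?P. F (h \<circ> \<pi>))"
    using sum.reindex_bij_betw[OF bij, of F] by (simp add: case_prod_unfold)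
  then show ?thesis by (simp add: sum.cartesian_product)
qed

text \<open>
  Expanding the product of sums in the Leibniz formula gives a sum over all functions \<open>f\<close> of
  \<open>\<Prod>\<^sub>i P i (f i)\<close> times a determinant that is alternating in \<open>f\<close>. Non-injective \<open>f\<close> contribute nothing,
  and the injective ones with a given image add up to the determinant of \<open>P\<close> on that image.
\<close>

theorem cauchy_binet:
  "det_on {1..m} {1..m} (\<lambda>i j. \<Sum>a=1..n. P i a * Q a j)
   = (\<Sum>h\<in>dec_functions m n. det_on {1..m} {1..m} (\<lambda>i k. P i (h k)) * det_on {1..m} {1..m} (\<lambda>k j. Q (h k) j))"
proof -
  let ?E = "{1..m} \<rightarrow>\<^sub>E {1..n}" and ?g = "\<lambda>f. det_on {1..m} {1..m} (\<lambda>k j. Q (f k) j)"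
  have "det_on {1..m} {1..m} (\<lambda>i j. \<Sum>a=1..n. P i a * Q a j)
      = (\<Sum>\<pi> | \<pi> permutes {1..m}. of_int (sign \<pi>) * (\<Sum>f\<in>?E. \<Prod>i=1..m. P i (f i) * Q (f i) (\<pi> i)))"
    unfolding det_on_leibniz by (subst prod_sum_PiE) auto
  also have "\<dots> = (\<Sum>f\<in>?E. (\<Prod>i=1..m. P i (f i)) * ?g f)"
    unfolding det_on_leibniz sum_distrib_left prod.distrib
    by (subst sum.swap) (auto intro!: sum.cong simp: mult_ac)
  also have "\<dots> = (\<Sum>f | f \<in> ?E \<and> inj_on f {1..m}. (\<Prod>i=1..m. P i (f i)) * ?g f)"
  proof (rule sum.mono_neutral_right)
    show "\<forall>f\<in>?E - {f. f \<in> ?E \<and> inj_on f {1..m}}. (\<Prod>i=1..m. P i (f i)) * ?g f = 0"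
    proof
      fix f assume "f \<in> ?E - {f. f \<in> ?E \<and> inj_on f {1..m}}"
      then obtain i j where "i \<in> {1..m}" "j \<in> {1..m}" "i \<noteq> j" "f i = f j"
        by (auto simp: inj_on_def)
      then have "?g f = 0" by (intro det_on_equal_rows[of i m j]) auto
      then show "(\<Prod>i=1..m. P i (f i)) * ?g f = 0" by simp
    qed
  qed (auto simp: finite_PiE)
  also have "\<dots> = (\<Sum>h\<in>dec_functions m n. \<Sum>\<pi> | \<pi> permutes {1..m}.
      (\<Prod>i=1..m. P i (h (\<pi> i))) * (of_int (sign \<pi>) * ?g h))"
    unfolding sum_over_injections
  proof (intro sum.cong refl)
    fix h \<pi> assume "\<pi> \<in> {\<pi>. \<pi> permutes {1..m}}"
    then have "?g (h \<circ> \<pi>) = of_int (sign \<pi>) * ?g h"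
      using det_on_permute_rows[of \<pi> m "\<lambda>k j. Q (h k) j"] by simp
    then show "(\<Prod>i=1..m. P i ((h \<circ> \<pi>) i)) * ?g (h \<circ> \<pi>)
        = (\<Prod>i=1..m. P i (h (\<pi> i))) * (of_int (sign \<pi>) * ?g h)"
      by simp
  qed
  also have "\<dots> = (\<Sum>h\<in>dec_functions m n. det_on {1..m} {1..m} (\<lambda>i k. P i (h k)) * ?g h)"
    unfolding det_on_leibniz[of m "\<lambda>i k. P i (_ k)"] sum_distrib_right
    by (intro sum.cong refl) (simp only: mult_ac)
  finally show ?thesis .
qed

section \<open>Complementary minors of the inverse matrix\<close>

text \<open>
  Lists of labels make the removal of a row or a column explicit, and labels of a sum type
  describe bordered matrices.
\<close>

definition ldet :: "'r list \<Rightarrow> 'c list \<Rightarrow> ('r \<Rightarrow> 'c \<Rightarrow> complex) \<Rightarrow> complex" where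
  "ldet rs cs a = det (mat (length rs) (length cs) (\<lambda>(i, j). a (rs ! i) (cs ! j)))"

lemma det_on_eq_ldet: "det_on A B a = ldet (sorted_list_of_set A) (sorted_list_of_set B) a"
  by (simp add: det_on_def ldet_def)

lemma ldet_map: "ldet (map f rs) (map g cs) a = ldet rs cs (\<lambda>r c. a (f r) (g c))"
  unfolding ldet_def by (auto intro!: arg_cong[of _ _ det] eq_matI)

lemma ldet_transpose:
  assumes "length rs = length cs"
  shows "ldet rs cs (\<lambda>r c. a c r) = ldet cs rs a"
proof -
  let ?M = "mat (length cs) (length rs) (\<lambda>(i, j). a (cs ! i) (rs ! j))"
  have "mat (length rs) (length cs) (\<lambda>(i, j). a (cs ! j) (rs ! i)) = transpose_mat ?M"
    by (intro eq_matI) auto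
  then show ?thesis
    unfolding ldet_def using det_transpose[of ?M "length rs"] assms by simp
qed

lemma ldet_unit_column:
  assumes len: "length ps + length qs = length cs"
    and zero: "\<And>p. p \<in> set ps \<union> set qs \<Longrightarrow> a p c = 0" and one: "a r c = 1"
  shows "ldet (ps @ r # qs) (c # cs) a = (-1) ^ length ps * ldet (ps @ qs) cs a"
proof -
  let ?rs = "ps @ r # qs" and ?N = "Suc (length cs)"
  let ?A = "mat (length ?rs) (length (c # cs)) (\<lambda>(i, j). a (?rs ! i) ((c # cs) ! j))"
  have A: "?A \<in> carrier_mat ?N ?N" using len by auto
  have entry: "?A $$ (i, 0) = (if i = length ps then 1 else 0)" if "i < ?N" for i
  proof -
    have "a (?rs ! i) c = 0" if "i \<noteq> length ps"
    proof -
      have "?rs ! i \<in> set ps \<union> set qs"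
        using \<open>i < ?N\<close> that len by (auto simp: nth_append nth_Cons split: nat.splits)
      then show ?thesis by (rule zero)
    qed
    then show ?thesis using that len one by auto
  qed
  have "det ?A = (\<Sum>i<?N. ?A $$ (i, 0) * cofactor ?A i 0)"
    by (rule laplace_expansion_column[OF A]) simp
  also have "\<dots> = (\<Sum>i<?N. if i = length ps then cofactor ?A i 0 else 0)"
    by (intro sum.cong refl, subst entry) simp_all
  also have "\<dots> = cofactor ?A (length ps) 0"
    using len by simp
  finally have "det ?A = cofactor ?A (length ps) 0" .
  moreover have "mat_delete ?A (length ps) 0
      = mat (length (ps @ qs)) (length cs) (\<lambda>(i, j). a ((ps @ qs) ! i) (cs ! j))"
    using len by (intro eq_matI) (auto simp: mat_delete_def nth_append)
  ultimately show ?thesis unfolding ldet_def by (simp add: cofactor_def)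
qed

lemma sorted_list_of_set_split:
  fixes R :: "nat set"
  assumes "finite R" "h \<in> R"
  obtains ps qs where "sorted_list_of_set R = ps @ h # qs" "sorted_list_of_set (R - {h}) = ps @ qs"
    "length ps = card {r \<in> R. r < h}"
proof -
  obtain ps qs where s: "sorted_list_of_set R = ps @ h # qs"
    using assms by (metis set_sorted_list_of_set split_list)
  have strict: "sorted_wrt (<) (ps @ h # qs)"
    using strict_sorted_list_of_set[of R] by (simp add: s)
  have R: "R = set ps \<union> {h} \<union> set qs"
    using assms s by (metis list.simps(15) set_append set_sorted_list_of_set insert_is_Un Un_assoc)
  have "{r \<in> R. r < h} = set ps"
    using strict unfolding R by (auto simp: sorted_wrt_append)
  moreover have "distinct ps" "h \<notin> set ps"
    using strict by (auto simp: sorted_wrt_append strict_sorted_iff)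
  ultimately have "length ps = card {r \<in> R. r < h}" "sorted_list_of_set (R - {h}) = ps @ qs"
    using assms s by (simp_all add: sorted_list_of_set_remove distinct_card remove1_append)
  then show ?thesis using that s by blast
qed

text \<open>
  Iterated Laplace expansion along the leading unit columns. As the labels decrease, each
  removal leaves the positions of the rows still to be removed unchanged; this is what keeps the
  exponent of the sign a plain sum.
\<close>

lemma ldet_unit_columns:
  fixes R :: "nat set" and a :: "'p + nat \<Rightarrow> nat + 'c \<Rightarrow> complex"
  assumes "finite R" "set hs \<subseteq> R" "sorted_wrt (>) hs"
    and "length ps + card R = length hs + length cs"
    and "\<And>p h. p \<in> set ps \<Longrightarrow> h \<in> set hs \<Longrightarrow> a (Inl p) (Inl h) = 0"
    and "\<And>r h. r \<in> R \<Longrightarrow> h \<in> set hs \<Longrightarrow> a (Inr r) (Inl h) = (if r = h then 1 else 0)"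
  shows "ldet (map Inl ps @ map Inr (sorted_list_of_set R)) (map Inl hs @ map Inr cs) a
    = (-1) ^ (\<Sum>h\<leftarrow>hs. length ps + card {r \<in> R. r < h})
      * ldet (map Inl ps @ map Inr (sorted_list_of_set (R - set hs))) (map Inr cs) a"
  using assms
proof (induction hs arbitrary: R)
  case Nil
  then show ?case by simp
next
  case (Cons h hs)
  obtain us vs where s: "sorted_list_of_set R = us @ h # vs" "sorted_list_of_set (R - {h}) = us @ vs"
      "length us = card {r \<in> R. r < h}"
    using sorted_list_of_set_split[of R h] Cons.prems by auto
  have sets: "set us \<union> set vs = R - {h}"
    using s(2) Cons.prems(1) by (metis finite_Diff set_append set_sorted_list_of_set)
  have cR: "card (R - {h}) = length us + length vs"
    using arg_cong[OF s(2), of length] by simp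
  have card: "card R = Suc (length us + length vs)"
    using arg_cong[OF s(1), of length] by simp
  let ?rest = "map Inl hs @ map Inr cs"
  have "ldet ((map Inl ps @ map Inr us) @ Inr h # map Inr vs) (Inl h # ?rest) a
      = (-1) ^ length (map Inl ps @ map Inr us)
        * ldet ((map Inl ps @ map Inr us) @ map Inr vs) ?rest a"
  proof (rule ldet_unit_column)
    show "length (map Inl ps @ map Inr us) + length (map Inr vs) = length ?rest"
      using Cons.prems(4) card by simp
    fix p assume "p \<in> set (map Inl ps @ map Inr us) \<union> set (map Inr vs)"
    then consider q where "p = Inl q" "q \<in> set ps" | r where "p = Inr r" "r \<in> R - {h}"
      unfolding sets[symmetric] by auto
    then show "a p (Inl h) = 0"
      using Cons.prems(5,6) by cases auto
  qed (use Cons.prems in auto)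
  then have "ldet (map Inl ps @ map Inr (sorted_list_of_set R)) (map Inl (h # hs) @ map Inr cs) a
      = (-1) ^ (length ps + card {r \<in> R. r < h})
        * ldet (map Inl ps @ map Inr (sorted_list_of_set (R - {h}))) ?rest a"
    by (simp add: s)
  also have "ldet (map Inl ps @ map Inr (sorted_list_of_set (R - {h}))) ?rest a
    = (-1) ^ (\<Sum>k\<leftarrow>hs. length ps + card {r \<in> R - {h}. r < k})
      * ldet (map Inl ps @ map Inr (sorted_list_of_set (R - {h} - set hs))) (map Inr cs) a"
  proof (rule Cons.IH)
    show "length ps + card (R - {h}) = length hs + length cs"
      using Cons.prems(4) card unfolding cR by simp
  qed (use Cons.prems in auto)
  also have "(\<Sum>k\<leftarrow>hs. length ps + card {r \<in> R - {h}. r < k}) = (\<Sum>k\<leftarrow>hs. length ps + card {r \<in> R. r < k})"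
  proof -
    have "{r \<in> R - {h}. r < k} = {r \<in> R. r < k}" if "k \<in> set hs" for k
      using that Cons.prems(3) by auto
    then show ?thesis by (intro arg_cong[of _ _ sum_list] map_cong) auto
  qed
  also have "R - {h} - set hs = R - set (h # hs)" by auto
  finally show ?case by (simp add: power_add mult.assoc)
qed

text \<open>
  The sign exponent of the preceding expansion for the rows selected by \<open>f\<close>: the zero-based
  position of \<open>f i\<close> in \<open>{1..n}\<close> is \<open>f i - 1\<close>, and the \<open>m\<close> on the left absorbs these subtractions.
\<close>

lemma sum_positions_dec:
  assumes f: "f \<in> dec_functions m n"
  shows "(\<Sum>h\<leftarrow>map f [1..<Suc m]. k + card {r \<in> {1..n}. r < h}) + m = k * m + (\<Sum>i=1..m. f i)"
proof -
  have c: "Suc (card {r \<in> {1..n}. r < f i}) = f i" if "i \<in> {1..m}" for i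
  proof -
    have "f i \<in> {1..n}" using f that unfolding dec_functions_def by auto
    then have "{r \<in> {1..n}. r < f i} = {1..<f i}" by auto
    then show ?thesis using \<open>f i \<in> {1..n}\<close> by simp
  qed
  have "(\<Sum>h\<leftarrow>map f [1..<Suc m]. k + card {r \<in> {1..n}. r < h}) + m
      = (\<Sum>i=1..m. k + card {r \<in> {1..n}. r < f i}) + (\<Sum>i=1..m. 1)"
    by (simp add: interv_sum_list_conv_sum_set_nat atLeastLessThanSuc_atLeastAtMost comp_def del: upt_Suc)
  also have "\<dots> = (\<Sum>i=1..m. k + Suc (card {r \<in> {1..n}. r < f i}))"
    by (simp add: sum.distrib sum_Suc)
  also have "\<dots> = (\<Sum>i=1..m. k + f i)"
    by (intro sum.cong refl) (simp only: c)
  finally show ?thesis by (simp add: sum.distrib)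
qed

text \<open>
  The block matrix \<open>(0 X; Y H)\<close> in which the border rows (labelled \<open>Inl f\<close>) and columns
  (labelled \<open>Inl h\<close>) are unit vectors. Its determinant is computed in two ways: expanding along the
  border leaves a complementary minor of \<open>H\<close>, while eliminating \<open>Y\<close> leaves a minor of the inverse.
\<close>

fun bordered :: "(nat \<Rightarrow> nat \<Rightarrow> complex) \<Rightarrow> nat + nat \<Rightarrow> nat + nat \<Rightarrow> complex" where
  "bordered H (Inl f) (Inl h) = 0"
| "bordered H (Inl f) (Inr c) = (if c = f then 1 else 0)"
| "bordered H (Inr r) (Inl h) = (if r = h then 1 else 0)"
| "bordered H (Inr r) (Inr c) = H r c"

text \<open>
  The unit columns remove the rows of \<open>H\<close> in the image of \<open>h\<close>; after transposing, the unit rows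
  remove the columns in the image of \<open>f\<close>.
\<close>

lemma ldet_bordered_minor:
  assumes f: "f \<in> dec_functions m n" and h: "h \<in> dec_functions m n" and mn: "m \<le> n"
  defines "fs \<equiv> map f [1..<Suc m]" and "hs \<equiv> map h [1..<Suc m]" and "N \<equiv> sorted_list_of_set {1..n}"
  shows "ldet (map Inl fs @ map Inr N) (map Inl hs @ map Inr N) (bordered H)
    = (-1) ^ (m + (\<Sum>i=1..m. f i + h i)) * det_on ({1..n} - h ` {1..m}) ({1..n} - f ` {1..m}) H"
proof -
  have s: "set [1..<Suc m] = {1..m}" by (simp only: set_upt atLeastLessThanSuc_atLeastAtMost)
  have sets: "set fs = f ` {1..m}" "set hs = h ` {1..m}"
    by (simp_all add: fs_def hs_def s del: upt_Suc set_upt)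
  have sub: "set fs \<subseteq> {1..n}" "set hs \<subseteq> {1..n}"
    using f h unfolding sets dec_functions_def by auto
  have dec: "sorted_wrt (>) fs" "sorted_wrt (>) hs"
    unfolding fs_def hs_def using dec_list_strict_sorted f h by blast+
  have len: "length fs = m" "length hs = m" "length N = n"
    by (simp_all add: fs_def hs_def N_def del: upt_Suc)
  have cards: "card ({1..n} - set fs) = n - m" "card ({1..n} - set hs) = n - m"
    using dec_functions_inj_on f h sub by (simp_all add: card_Diff_subset card_image sets)
  let ?Rh = "sorted_list_of_set ({1..n} - set hs)" and ?Rf = "sorted_list_of_set ({1..n} - set fs)"
  let ?bT = "\<lambda>x y. bordered H y x"
  define e1 where "e1 = (\<Sum>k\<leftarrow>hs. m + card {r \<in> {1..n}. r < k})"
  define e2 where "e2 = (\<Sum>k\<leftarrow>fs. length ([] :: nat list) + card {r \<in> {1..n}. r < k})"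
  have "ldet (map Inl fs @ map Inr N) (map Inl hs @ map Inr N) (bordered H)
     = (-1) ^ e1 * ldet (map Inl fs @ map Inr ?Rh) (map Inr N) (bordered H)"
    unfolding e1_def len(1)[symmetric] unfolding N_def
    by (rule ldet_unit_columns) (use sub dec len in auto)
  also have "ldet (map Inl fs @ map Inr ?Rh) (map Inr N) (bordered H)
     = ldet (map Inl [] @ map Inr N) (map Inl fs @ map Inr ?Rh) ?bT"
    using ldet_transpose[of "map Inl fs @ map Inr ?Rh" "map Inr N" ?bT] len cards mn by simp
  also have "\<dots> = (-1) ^ e2 * ldet (map Inl [] @ map Inr ?Rf) (map Inr ?Rh) ?bT"
    unfolding e2_def N_def
    by (rule ldet_unit_columns) (use sub dec len cards mn in auto)
  also have "ldet (map Inl [] @ map Inr ?Rf) (map Inr ?Rh) ?bT = ldet ?Rh ?Rf H"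
    using ldet_transpose[of ?Rf ?Rh H] cards by (simp add: ldet_map)
  also have "ldet ?Rh ?Rf H = det_on ({1..n} - h ` {1..m}) ({1..n} - f ` {1..m}) H"
    by (simp add: det_on_eq_ldet sets)
  also have "(-1) ^ e1 * ((-1) ^ e2 * det_on ({1..n} - h ` {1..m}) ({1..n} - f ` {1..m}) H)
     = (-1) ^ (e1 + e2) * det_on ({1..n} - h ` {1..m}) ({1..n} - f ` {1..m}) H"
    by (simp add: power_add)
  also have "(-1 :: complex) ^ (e1 + e2) = (-1) ^ (m + (\<Sum>i=1..m. f i + h i))"
  proof -
    have "e1 + m = m * m + (\<Sum>i=1..m. h i)" "e2 + m = (\<Sum>i=1..m. f i)"
      using sum_positions_dec[OF h, of m] sum_positions_dec[OF f, of 0] by (simp_all add: e1_def e2_def fs_def hs_def del: upt_Suc)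
    then have "e1 + e2 + 2 * m = m * m + (\<Sum>i=1..m. f i + h i)"
      by (simp add: sum.distrib)
    then have "even (e1 + e2) \<longleftrightarrow> even (m * m + (\<Sum>i=1..m. f i + h i))"
      by (metis dvd_triv_left even_add)
    then have "even (e1 + e2) \<longleftrightarrow> even (m + (\<Sum>i=1..m. f i + h i))" by simp
    then show ?thesis by (simp add: uminus_power_if)
  qed
  finally show ?thesis .
qed

text \<open>
  Multiplying \<open>(0 X; Y H)\<close> from the right by \<open>(1 0; -BY 1)\<close>, of determinant one, gives
  \<open>(-XBY X; 0 H)\<close> because \<open>H B = 1\<close>, and \<open>XBY\<close> is the submatrix of \<open>B\<close> selected by \<open>f\<close> and \<open>h\<close>.
\<close>

lemma ldet_bordered_schur:
  assumes f: "f \<in> dec_functions m n" and h: "h \<in> dec_functions m n"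
    and inv: "\<And>r c. r \<in> {1..n} \<Longrightarrow> c \<in> {1..n} \<Longrightarrow> (\<Sum>b=1..n. H r b * B b c) = (if r = c then 1 else 0)"
  defines "fs \<equiv> map f [1..<Suc m]" and "hs \<equiv> map h [1..<Suc m]" and "N \<equiv> sorted_list_of_set {1..n}"
  shows "ldet (map Inl fs @ map Inr N) (map Inl hs @ map Inr N) (bordered H)
    = (-1) ^ m * det_on {1..m} {1..m} (\<lambda>i j. B (f i) (h j)) * det_on {1..n} {1..n} H"
proof -
  have N: "N = [1..<Suc n]" unfolding N_def by (simp add: atLeastLessThanSuc_atLeastAtMost[symmetric] del: upt_Suc)
  have len: "length fs = m" "length hs = m" "length N = n"
    by (simp_all add: fs_def hs_def N del: upt_Suc)
  have nth: "k < m \<Longrightarrow> fs ! k = f (Suc k)" "k < m \<Longrightarrow> hs ! k = h (Suc k)" "k < n \<Longrightarrow> N ! k = Suc k" for k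
    by (simp_all add: fs_def hs_def N One_nat_def del: upt_Suc)
  have rng: "f (Suc i) \<in> {1..n}" "h (Suc i) \<in> {1..n}" if "i < m" for i
    using f h that unfolding dec_functions_def by (auto dest!: PiE_mem[where x = "Suc i"])
  let ?X = "mat m n (\<lambda>(i, j). if Suc j = f (Suc i) then 1 else 0 :: complex)"
  let ?Y = "mat n m (\<lambda>(i, j). if Suc i = h (Suc j) then 1 else 0 :: complex)"
  let ?H = "mat n n (\<lambda>(i, j). H (Suc i) (Suc j))"
  let ?Z = "mat n m (\<lambda>(i, j). - B (Suc i) (h (Suc j)))"
  let ?W = "mat m m (\<lambda>(i, j). B (f (Suc i)) (h (Suc j)))"
  let ?M = "four_block_mat (0\<^sub>m m m) ?X ?Y ?H"
  let ?E = "four_block_mat (1\<^sub>m m) (0\<^sub>m m n) ?Z (1\<^sub>m n)"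
  have block: "ldet (map Inl fs @ map Inr N) (map Inl hs @ map Inr N) (bordered H) = det ?M"
    unfolding ldet_def
    by (intro arg_cong[of _ _ det] eq_matI) (auto simp: len nth nth_append)
  have shift: "(\<Sum>k=0..<n. g (Suc k)) = (\<Sum>k=1..n. g k)" for g :: "nat \<Rightarrow> complex"
    by (simp add: One_nat_def sum.atLeast1_atMost_eq lessThan_atLeast0)
  \<comment> \<open>\<open>?Z\<close> is \<open>-B Y\<close>, \<open>?W\<close> is \<open>X B Y\<close>.\<close>
  have XZ: "?X * ?Z = (-1) \<cdot>\<^sub>m ?W"
  proof (intro eq_matI)
    fix i j assume "i < dim_row ((-1) \<cdot>\<^sub>m ?W)" "j < dim_col ((-1) \<cdot>\<^sub>m ?W)"
    then have ij: "i < m" "j < m" by auto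
    then have "(?X * ?Z) $$ (i, j) = (\<Sum>k=0..<n. (if Suc k = f (Suc i) then 1 else 0) * - B (Suc k) (h (Suc j)))"
      by (simp add: scalar_prod_def)
    also have "\<dots> = (\<Sum>k=1..n. (if k = f (Suc i) then 1 else 0) * - B k (h (Suc j)))"
      by (rule shift)
    also have "\<dots> = (\<Sum>k=1..n. if k = f (Suc i) then - B k (h (Suc j)) else 0)"
      by (intro sum.cong) auto
    also have "\<dots> = - B (f (Suc i)) (h (Suc j))" using rng(1)[OF ij(1)] by simp
    finally show "(?X * ?Z) $$ (i, j) = ((-1) \<cdot>\<^sub>m ?W) $$ (i, j)" using ij by simp
  qed auto
  have HZ: "?Y + ?H * ?Z = 0\<^sub>m n m"
  proof (intro eq_matI)
    fix i j assume "i < dim_row (0\<^sub>m n m :: complex mat)" "j < dim_col (0\<^sub>m n m :: complex mat)"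
    then have ij: "i < n" "j < m" by auto
    then have "(?H * ?Z) $$ (i, j) = (\<Sum>k=0..<n. - (H (Suc i) (Suc k) * B (Suc k) (h (Suc j))))"
      by (simp add: scalar_prod_def)
    also have "\<dots> = - (\<Sum>k=1..n. H (Suc i) k * B k (h (Suc j)))"
      by (subst shift) (simp add: sum_negf)
    also have "\<dots> = - (if Suc i = h (Suc j) then 1 else 0)"
      using ij rng(2)[OF ij(2)] by (subst inv) auto
    finally show "(?Y + ?H * ?Z) $$ (i, j) = (0\<^sub>m n m) $$ (i, j)"
      using ij by (simp del: index_mult_mat(1))
  qed auto
  have "?M * ?E = four_block_mat ((-1) \<cdot>\<^sub>m ?W) ?X (0\<^sub>m n m) ?H"
    using XZ HZ
    by (subst mult_four_block_mat[of _ m m _ n _ n]) auto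
  then have "det (?M * ?E) = det ((-1) \<cdot>\<^sub>m ?W) * det ?H"
    by (simp add: det_four_block_mat_lower_left_zero[of _ m _ n])
  moreover have "det ?E = 1"
    by (subst det_four_block_mat_upper_right_zero[of _ m _ n]) auto
  moreover have "det (?M * ?E) = det ?M * det ?E"
    by (rule det_mult[of _ "m + n"]) auto
  ultimately show ?thesis
    using block by (simp add: det_smult det_on_interval)
qed

text \<open>
  Both evaluations of the bordered determinant carry the sign \<open>(-1)\<^sup>m\<close>, which therefore cancels.
\<close>

theorem jacobi_complementary_minor:
  assumes f: "f \<in> dec_functions m n" and h: "h \<in> dec_functions m n" and mn: "m \<le> n"
    and inv: "\<And>r c. r \<in> {1..n} \<Longrightarrow> c \<in> {1..n} \<Longrightarrow> (\<Sum>b=1..n. H r b * B b c) = (if r = c then 1 else 0)"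
  shows "det_on {1..m} {1..m} (\<lambda>i j. B (f i) (h j)) * det_on {1..n} {1..n} H
    = (-1) ^ (\<Sum>i=1..m. f i + h i) * det_on ({1..n} - h ` {1..m}) ({1..n} - f ` {1..m}) H"
proof -
  have "(-1) ^ m * (det_on {1..m} {1..m} (\<lambda>i j. B (f i) (h j)) * det_on {1..n} {1..n} H)
    = (-1) ^ m * ((-1) ^ (\<Sum>i=1..m. f i + h i) * det_on ({1..n} - h ` {1..m}) ({1..n} - f ` {1..m}) H)"
    using ldet_bordered_minor[OF f h mn, of H] ldet_bordered_schur[OF f h inv]
    by (simp add: power_add mult.assoc)
  then show ?thesis by simp
qed

section \<open>Polynomial functions in several variables\<close>

text \<open>
  Any finite sum of monomials is admissible: exponents may be repeated and may be arbitrary outside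
  \<open>{1..m}\<close>, since equal monomials are collected.
\<close>

lemma mpoly_belowI:
  assumes "finite A" and f: "\<And>x. f x = (\<Sum>a\<in>A. c a * mono_val m (e a) x)"
    and e: "\<And>a i. a \<in> A \<Longrightarrow> i \<in> {1..m} \<Longrightarrow> e a i < n"
  shows "mpoly_below n m f"
  unfolding mpoly_below_def
proof (intro exI allI)
  let ?E = "{1..m} \<rightarrow>\<^sub>E {..<n}" and ?r = "\<lambda>a. restrict (e a) {1..m}"
  fix x
  have r: "?r ` A \<subseteq> ?E" using e by auto
  have mono: "mono_val m (?r a) x = mono_val m (e a) x" for a
    unfolding mono_val_def by (rule prod.cong) auto
  have "f x = (\<Sum>\<alpha>\<in>?E. \<Sum>a | a \<in> A \<and> ?r a = \<alpha>. c a * mono_val m (?r a) x)"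
    unfolding f mono using r assms(1)
    by (intro sum.group[symmetric]) (auto simp: finite_PiE)
  also have "\<dots> = (\<Sum>\<alpha>\<in>?E. (\<Sum>a | a \<in> A \<and> ?r a = \<alpha>. c a) * mono_val m \<alpha> x)"
    unfolding sum_distrib_right by (intro sum.cong refl) auto
  finally show "f x = (\<Sum>\<alpha>\<in>?E. (\<Sum>a | a \<in> A \<and> ?r a = \<alpha>. c a) * mono_val m \<alpha> x)" .
qed

lemma finite_exponents: "finite ({1..m::nat} \<rightarrow>\<^sub>E {..<n::nat})"
  by (simp add: finite_PiE)

lemma exponent_less: "\<alpha> \<in> {1..m} \<rightarrow>\<^sub>E {..<n} \<Longrightarrow> i \<in> {1..m} \<Longrightarrow> \<alpha> i < (n::nat)"
  by (drule PiE_mem) auto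

lemma mpoly_below_mono:
  assumes "mpoly_below n m f" "n \<le> n'"
  shows "mpoly_below n' m f"
proof -
  obtain a where "\<And>x. f x = (\<Sum>\<alpha>\<in>{1..m} \<rightarrow>\<^sub>E {..<n}. a \<alpha> * mono_val m \<alpha> x)"
    using assms(1) unfolding mpoly_below_def by blast
  then show ?thesis
  proof (rule mpoly_belowI[OF finite_exponents])
    fix \<alpha> i assume "\<alpha> \<in> {1..m} \<rightarrow>\<^sub>E {..<n}" "i \<in> {1..m}"
    then show "\<alpha> i < n'" using exponent_less[of \<alpha> m n i] assms(2) by linarith
  qed
qed

lemma mpoly_below_const_mult:
  assumes "mpoly_below n m f" shows "mpoly_below n m (\<lambda>x. c * f x)"
proof -
  obtain a where a: "\<And>x. f x = (\<Sum>\<alpha>\<in>{1..m} \<rightarrow>\<^sub>E {..<n}. a \<alpha> * mono_val m \<alpha> x)"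
    using assms(1) unfolding mpoly_below_def by blast
  then show ?thesis
    unfolding mpoly_below_def a sum_distrib_left
    by (intro exI[of _ "\<lambda>\<alpha>. c * a \<alpha>"]) (simp add: mult.assoc)
qed

lemma mpoly_below_add:
  assumes "mpoly_below n m f" "mpoly_below n m g" shows "mpoly_below n m (\<lambda>x. f x + g x)"
proof -
  obtain a b where "\<And>x. f x = (\<Sum>\<alpha>\<in>{1..m} \<rightarrow>\<^sub>E {..<n}. a \<alpha> * mono_val m \<alpha> x)"
    "\<And>x. g x = (\<Sum>\<alpha>\<in>{1..m} \<rightarrow>\<^sub>E {..<n}. b \<alpha> * mono_val m \<alpha> x)"
    using assms unfolding mpoly_below_def by blast
  then show ?thesis
    unfolding mpoly_below_def
    by (intro exI[of _ "\<lambda>\<alpha>. a \<alpha> + b \<alpha>"]) (simp add: distrib_right sum.distrib)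
qed

lemma mpoly_below_sum:
  assumes "\<And>a. a \<in> A \<Longrightarrow> mpoly_below n m (f a)" shows "mpoly_below n m (\<lambda>x. \<Sum>a\<in>A. f a x)"
  using assms
proof (induction A rule: infinite_finite_induct)
  case (insert a A)
  then show ?case using mpoly_below_add[of n m "f a"] by simp
qed (auto simp: mpoly_below_def intro!: exI[of _ "\<lambda>_. 0"])

lemma is_mpoly_const: "is_mpoly m (\<lambda>_. c)"
  unfolding is_mpoly_def
  by (intro exI[of _ 1] mpoly_belowI[of "{()}" _ "\<lambda>_. c" m "\<lambda>_ _. 0"]) (auto simp: mono_val_def)

lemma is_mpoly_var:
  assumes "k \<in> {1..m}" shows "is_mpoly m (\<lambda>x. x k)"
proof -
  have "mono_val m (\<lambda>i. if i = k then 1 else 0) x = x k" for x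
  proof -
    have "mono_val m (\<lambda>i. if i = k then 1 else 0) x = (\<Prod>i=1..m. if i = k then x k else 1)"
      unfolding mono_val_def by (intro prod.cong) auto
    then show ?thesis using assms by simp
  qed
  then show ?thesis
    unfolding is_mpoly_def
    by (intro exI[of _ 2] mpoly_belowI[of "{()}" _ "\<lambda>_. 1" m "\<lambda>_ i. if i = k then 1 else 0"]) auto
qed

lemma is_mpoly_common:
  assumes "is_mpoly m f" "is_mpoly m g"
  obtains n where "mpoly_below n m f" "mpoly_below n m g"
proof -
  obtain n1 n2 where "mpoly_below n1 m f" "mpoly_below n2 m g"
    using assms unfolding is_mpoly_def by blast
  then show ?thesis
    by (intro that[of "max n1 n2"]; elim mpoly_below_mono) auto
qed

lemma is_mpoly_add: "is_mpoly m f \<Longrightarrow> is_mpoly m g \<Longrightarrow> is_mpoly m (\<lambda>x. f x + g x)"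
  by (rule is_mpoly_common[of m f g]) (auto simp: is_mpoly_def intro: mpoly_below_add)

lemma is_mpoly_mult:
  assumes "is_mpoly m f" "is_mpoly m g" shows "is_mpoly m (\<lambda>x. f x * g x)"
proof -
  obtain n where n: "mpoly_below n m f" "mpoly_below n m g"
    using assms by (rule is_mpoly_common)
  let ?E = "{1..m} \<rightarrow>\<^sub>E {..<n}"
  obtain a b where ab: "\<And>x. f x = (\<Sum>\<alpha>\<in>?E. a \<alpha> * mono_val m \<alpha> x)"
    "\<And>x. g x = (\<Sum>\<beta>\<in>?E. b \<beta> * mono_val m \<beta> x)"
    using n unfolding mpoly_below_def by blast
  have "mpoly_below (2 * n) m (\<lambda>x. f x * g x)"
  proof (rule mpoly_belowI[of "?E \<times> ?E" _ "\<lambda>(\<alpha>, \<beta>). a \<alpha> * b \<beta>" m "\<lambda>(\<alpha>, \<beta>) i. \<alpha> i + \<beta> i"])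
    fix x
    have "mono_val m (\<lambda>i. \<alpha> i + \<beta> i) x = mono_val m \<alpha> x * mono_val m \<beta> x" for \<alpha> \<beta>
      by (simp add: mono_val_def power_add prod.distrib)
    then show "f x * g x = (\<Sum>p\<in>?E \<times> ?E. (case p of (\<alpha>, \<beta>) \<Rightarrow> a \<alpha> * b \<beta>) *
        mono_val m (case p of (\<alpha>, \<beta>) \<Rightarrow> \<lambda>i. \<alpha> i + \<beta> i) x)"
      unfolding ab sum_product sum.cartesian_product
      by (intro sum.cong refl) (auto simp: mult_ac)
  next
    fix p i assume "p \<in> ?E \<times> ?E" "i \<in> {1..m}"
    then show "(case p of (\<alpha>, \<beta>) \<Rightarrow> \<lambda>i. \<alpha> i + \<beta> i) i < 2 * n"
      using exponent_less[of "fst p" m n i] exponent_less[of "snd p" m n i] by (auto split: prod.splits)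
  qed (simp add: finite_exponents)
  then show ?thesis unfolding is_mpoly_def by blast
qed

lemma is_mpoly_sum: "(\<And>a. a \<in> A \<Longrightarrow> is_mpoly m (f a)) \<Longrightarrow> is_mpoly m (\<lambda>x. \<Sum>a\<in>A. f a x)"
proof (induction A rule: infinite_finite_induct)
  case (insert a A)
  then show ?case using is_mpoly_add[of m "f a"] by simp
qed (simp_all add: is_mpoly_const)

lemma is_mpoly_prod: "(\<And>a. a \<in> A \<Longrightarrow> is_mpoly m (f a)) \<Longrightarrow> is_mpoly m (\<lambda>x. \<Prod>a\<in>A. f a x)"
proof (induction A rule: infinite_finite_induct)
  case (insert a A)
  then show ?case using is_mpoly_mult[of m "f a"] by simp
qed (simp_all add: is_mpoly_const)

lemma is_mpoly_det_on:
  assumes "\<And>i j. i \<in> {1..m} \<Longrightarrow> j \<in> {1..m} \<Longrightarrow> is_mpoly m (a i j)"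
  shows "is_mpoly m (\<lambda>x. det_on {1..m} {1..m} (\<lambda>i j. a i j x))"
  unfolding det_on_leibniz
proof (intro is_mpoly_sum is_mpoly_mult is_mpoly_const is_mpoly_prod assms)
  fix \<pi> i assume "\<pi> \<in> {\<pi>. \<pi> permutes {1..m}}" "i \<in> {1..m}"
  then show "\<pi> i \<in> {1..m}" by (simp only: mem_Collect_eq permutes_in_image)
qed

text \<open>
  A line through \<open>x\<close> whose direction has pairwise distinct coordinates, so that it leaves the zero
  set of the Vandermonde product. Restriction to such lines reduces identities between polynomials in
  several variables to one variable.
\<close>

definition line :: "(nat \<Rightarrow> complex) \<Rightarrow> complex \<Rightarrow> nat \<Rightarrow> complex" where
  "line x t = (\<lambda>i. x i + t * of_nat i)"

lemma mono_val_line: "mono_val m \<alpha> (line x t) = poly (\<Prod>i=1..m. [:x i, of_nat i:] ^ \<alpha> i) t"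
  by (simp add: mono_val_def line_def poly_prod)

lemma is_mpoly_line:
  assumes "is_mpoly m f"
  obtains q where "\<And>t. f (line x t) = poly q t"
proof -
  obtain n a where a: "\<And>x. f x = (\<Sum>\<alpha>\<in>{1..m} \<rightarrow>\<^sub>E {..<n}. a \<alpha> * mono_val m \<alpha> x)"
    using assms unfolding is_mpoly_def mpoly_below_def by blast
  show ?thesis
    by (rule that[of "\<Sum>\<alpha>\<in>{1..m} \<rightarrow>\<^sub>E {..<n}. smult (a \<alpha>) (\<Prod>i=1..m. [:x i, of_nat i:] ^ \<alpha> i)"])
       (simp add: a mono_val_line poly_sum)
qed

lemma is_mpoly2_line:
  assumes "is_mpoly2 m F"
  obtains q where "\<And>t. F (line x t) (line y t) = poly q t"
proof -
  obtain n a where a: "\<And>x y. F x y = (\<Sum>\<alpha>\<in>{1..m} \<rightarrow>\<^sub>E {..<n}. \<Sum>\<beta>\<in>{1..m} \<rightarrow>\<^sub>E {..<n}.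
        a \<alpha> \<beta> * mono_val m \<alpha> x * mono_val m \<beta> y)"
    using assms unfolding is_mpoly2_def by blast
  show ?thesis
    by (rule that[of "\<Sum>\<alpha>\<in>{1..m} \<rightarrow>\<^sub>E {..<n}. \<Sum>\<beta>\<in>{1..m} \<rightarrow>\<^sub>E {..<n}.
        smult (a \<alpha> \<beta>) ((\<Prod>i=1..m. [:x i, of_nat i:] ^ \<alpha> i) * (\<Prod>i=1..m. [:y i, of_nat i:] ^ \<beta> i))"])
       (simp add: a mono_val_line poly_sum mult.assoc)
qed

lemma finite_vandermonde_line_zeros: "finite {t. vandermonde m (line x t) = 0}"
proof -
  have "{t. vandermonde m (line x t) = 0} \<subseteq>
      (\<Union>j\<in>{1..m}. \<Union>i\<in>{1..<j}. {(x i - x j) / (of_nat j - of_nat i)})"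
  proof
    fix t assume "t \<in> {t. vandermonde m (line x t) = 0}"
    then obtain i j where ij: "j \<in> {1..m}" "i \<in> {1..<j}" and "line x t j - line x t i = 0"
      unfolding vandermonde_def by auto
    then have "t * (of_nat j - of_nat i) = x i - x j"
      by (simp add: line_def algebra_simps)
    moreover have "(of_nat j - of_nat i :: complex) \<noteq> 0" using ij by simp
    ultimately have "t = (x i - x j) / (of_nat j - of_nat i)" by (simp add: field_simps)
    then show "t \<in> (\<Union>j\<in>{1..m}. \<Union>i\<in>{1..<j}. {(x i - x j) / (of_nat j - of_nat i)})"
      using ij by blast
  qed
  then show ?thesis by (rule finite_subset) auto
qed

lemma poly_eqI_cofinite:
  fixes p q :: "complex poly"
  assumes "finite {t. \<not> P t}" "\<And>t. P t \<Longrightarrow> poly p t = poly q t"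
  shows "p = q"
proof (rule ccontr)
  assume "p \<noteq> q"
  then have "finite {t. poly (p - q) t = 0}" by (intro poly_roots_finite) simp
  moreover have "UNIV \<subseteq> {t. \<not> P t} \<union> {t. poly (p - q) t = 0}"
    using assms(2) by auto
  ultimately have "finite (UNIV :: complex set)"
    using assms(1) by (meson finite_UnI finite_subset)
  then show False by (simp add: infinite_UNIV_char_0)
qed

text \<open>
  Restricted to the line through \<open>x\<close>, both sides are polynomials in one variable that agree outside
  the finitely many zeros of the Vandermonde product, hence also at \<open>x\<close> itself.
\<close>

lemma is_mpoly_vandermonde_cancel:
  assumes f: "is_mpoly m f" and g: "is_mpoly m g"
    and eq: "\<And>x. f x * vandermonde m x = g x * vandermonde m x"
  shows "f = g"
proof
  fix x
  obtain p q where pq: "\<And>t. f (line x t) = poly p t" "\<And>t. g (line x t) = poly q t"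
    using is_mpoly_line[OF f] is_mpoly_line[OF g] by metis
  have "p = q"
    by (rule poly_eqI_cofinite[of "\<lambda>t. vandermonde m (line x t) \<noteq> 0"])
       (use eq finite_vandermonde_line_zeros in \<open>auto simp: pq[symmetric]\<close>)
  then show "f x = g x" using pq[of 0] by (simp add: line_def)
qed

lemma is_mpoly2_vandermonde_cancel:
  assumes F: "is_mpoly2 m F" and G: "is_mpoly2 m G"
    and eq: "\<And>x y. vandermonde m x * vandermonde m y * F x y = vandermonde m x * vandermonde m y * G x y"
  shows "F = G"
proof (intro ext)
  fix x y
  obtain p q where pq: "\<And>t. F (line x t) (line y t) = poly p t" "\<And>t. G (line x t) (line y t) = poly q t"
    using is_mpoly2_line[OF F] is_mpoly2_line[OF G] by metis
  have "p = q"
  proof (rule poly_eqI_cofinite[of "\<lambda>t. vandermonde m (line x t) \<noteq> 0 \<and> vandermonde m (line y t) \<noteq> 0"])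
    have "{t. \<not> (vandermonde m (line x t) \<noteq> 0 \<and> vandermonde m (line y t) \<noteq> 0)}
      = {t. vandermonde m (line x t) = 0} \<union> {t. vandermonde m (line y t) = 0}" by auto
    then show "finite {t. \<not> (vandermonde m (line x t) \<noteq> 0 \<and> vandermonde m (line y t) \<noteq> 0)}"
      by (simp add: finite_vandermonde_line_zeros)
    show "poly p t = poly q t"
      if "vandermonde m (line x t) \<noteq> 0 \<and> vandermonde m (line y t) \<noteq> 0" for t
      using eq[of "line x t" "line y t"] that by (simp add: pq)
  qed
  then show "F x y = G x y" using pq[of 0] by (simp add: line_def)
qed

text \<open>
  The factors may have different degrees; all are first bounded by the sum of their degree bounds.
\<close>

lemma is_mpoly2_sum_products:
  assumes "finite A" and f: "\<And>a. a \<in> A \<Longrightarrow> is_mpoly m (f a)" and g: "\<And>a. a \<in> A \<Longrightarrow> is_mpoly m (g a)"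
  shows "is_mpoly2 m (\<lambda>x y. \<Sum>a\<in>A. f a x * g a y)"
proof -
  have "\<forall>a\<in>A. \<exists>n. mpoly_below n m (f a) \<and> mpoly_below n m (g a)"
    using is_mpoly_common[OF f g] by metis
  then obtain d where d: "\<And>a. a \<in> A \<Longrightarrow> mpoly_below (d a) m (f a) \<and> mpoly_below (d a) m (g a)"
    by metis
  define n where "n = sum d A"
  have "d a \<le> n" if "a \<in> A" for a
    unfolding n_def using assms(1) that by (intro member_le_sum) auto
  then have n: "\<forall>a\<in>A. mpoly_below n m (f a) \<and> mpoly_below n m (g a)"
    using d mpoly_below_mono by blast
  let ?E = "{1..m} \<rightarrow>\<^sub>E {..<n}"
  have "\<forall>a\<in>A. \<exists>b. \<forall>x. f a x = (\<Sum>\<alpha>\<in>?E. b \<alpha> * mono_val m \<alpha> x)"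
    and "\<forall>a\<in>A. \<exists>b. \<forall>x. g a x = (\<Sum>\<alpha>\<in>?E. b \<alpha> * mono_val m \<alpha> x)"
    using n unfolding mpoly_below_def by blast+
  then obtain b c where b: "\<And>a x. a \<in> A \<Longrightarrow> f a x = (\<Sum>\<alpha>\<in>?E. b a \<alpha> * mono_val m \<alpha> x)"
    and c: "\<And>a x. a \<in> A \<Longrightarrow> g a x = (\<Sum>\<alpha>\<in>?E. c a \<alpha> * mono_val m \<alpha> x)"
    unfolding bchoice_iff by blast
  have "(\<Sum>a\<in>A. f a x * g a y) = (\<Sum>\<alpha>\<in>?E. \<Sum>\<beta>\<in>?E.
      (\<Sum>a\<in>A. b a \<alpha> * c a \<beta>) * mono_val m \<alpha> x * mono_val m \<beta> y)" for x y
  proof -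
    have "(\<Sum>a\<in>A. f a x * g a y)
        = (\<Sum>a\<in>A. \<Sum>\<alpha>\<in>?E. \<Sum>\<beta>\<in>?E. b a \<alpha> * c a \<beta> * mono_val m \<alpha> x * mono_val m \<beta> y)"
      by (intro sum.cong refl) (simp add: b c sum_product mult_ac)
    also have "\<dots> = (\<Sum>\<alpha>\<in>?E. \<Sum>a\<in>A. \<Sum>\<beta>\<in>?E. b a \<alpha> * c a \<beta> * mono_val m \<alpha> x * mono_val m \<beta> y)"
      by (rule sum.swap)
    also have "\<dots> = (\<Sum>\<alpha>\<in>?E. \<Sum>\<beta>\<in>?E. \<Sum>a\<in>A. b a \<alpha> * c a \<beta> * mono_val m \<alpha> x * mono_val m \<beta> y)"
      by (intro sum.cong refl sum.swap)
    finally show ?thesis by (simp only: sum_distrib_right)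
  qed
  then show ?thesis
    unfolding is_mpoly2_def
    by (intro exI[of _ n] exI[of _ "\<lambda>\<alpha> \<beta>. \<Sum>a\<in>A. b a \<alpha> * c a \<beta>"]) blast
qed

section \<open>Schur polynomials as quotients of alternants\<close>

text \<open>
  The complete homogeneous symmetric polynomial of degree \<open>d\<close> in \<open>x 1, \<dots>, x k\<close>, by splitting off
  the monomials that contain \<open>x k\<close>.
\<close>

fun complete_hom :: "nat \<Rightarrow> nat \<Rightarrow> (nat \<Rightarrow> complex) \<Rightarrow> complex" where
  "complete_hom k 0 x = 1"
| "complete_hom 0 (Suc d) x = 0"
| "complete_hom (Suc k) (Suc d) x = complete_hom k (Suc d) x + x (Suc k) * complete_hom (Suc k) d x"

lemma is_mpoly_complete_hom: "k \<le> m \<Longrightarrow> is_mpoly m (\<lambda>x. complete_hom k d x)"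
proof (induction k arbitrary: d)
  case 0
  show ?case by (cases d) (simp_all add: is_mpoly_const)
next
  case (Suc k)
  have "complete_hom (Suc k) 0 = (\<lambda>_. 1)"
    and "complete_hom (Suc k) (Suc d) = (\<lambda>x. complete_hom k (Suc d) x + x (Suc k) * complete_hom (Suc k) d x)" for d
    by (simp_all add: fun_eq_iff)
  with Suc show ?case
    by (induction d) (auto intro!: is_mpoly_add is_mpoly_mult is_mpoly_var is_mpoly_const)
qed

text \<open>
  Newton interpolation of the monomial \<open>t\<^bsup>e\<^esup>\<close> at the nodes \<open>x 1, x 2, \<dots>\<close>, whose divided differences
  are complete homogeneous polynomials.
\<close>

lemma power_newton:
  "t ^ e = (\<Sum>k\<le>e. complete_hom (Suc k) (e - k) x * (\<Prod>l=1..k. (t - x l)))"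
proof (induction e)
  case 0
  show ?case by simp
next
  case (Suc e)
  let ?N = "\<lambda>k. \<Prod>l=1..k. (t - x l)" and ?h = "\<lambda>k d. complete_hom k d x"
  have step: "t * ?N k = ?N (Suc k) + x (Suc k) * ?N k" for k
    by (simp add: algebra_simps)
  have "t ^ Suc e = (\<Sum>k\<le>e. ?h (Suc k) (e - k) * (t * ?N k))"
    by (simp add: Suc sum_distrib_left mult_ac)
  also have "\<dots> = (\<Sum>k\<le>e. ?h (Suc k) (e - k) * ?N (Suc k) + x (Suc k) * ?h (Suc k) (e - k) * ?N k)"
    unfolding step by (intro sum.cong refl) (simp only: distrib_left mult_ac)
  also have "\<dots> = (\<Sum>k\<le>e. ?h (Suc k) (e - k) * ?N (Suc k)) + (\<Sum>k\<le>e. x (Suc k) * ?h (Suc k) (e - k) * ?N k)"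
    by (rule sum.distrib)
  also have "(\<Sum>k\<le>e. ?h (Suc k) (e - k) * ?N (Suc k)) = (\<Sum>k\<le>Suc e. ?h k (Suc e - k) * ?N k)"
    unfolding sum.atMost_Suc_shift by simp
  also have "\<dots> = ?N (Suc e) + (\<Sum>k\<le>e. ?h k (Suc (e - k)) * ?N k)"
    by (simp add: Suc_diff_le)
  also have "?N (Suc e) + (\<Sum>k\<le>e. ?h k (Suc (e - k)) * ?N k) + (\<Sum>k\<le>e. x (Suc k) * ?h (Suc k) (e - k) * ?N k)
     = ?N (Suc e) + (\<Sum>k\<le>e. ?h (Suc k) (Suc e - k) * ?N k)"
    unfolding add.assoc sum.distrib[symmetric]
    by (intro arg_cong2[of _ _ _ _ "(+)"] refl sum.cong) (simp add: Suc_diff_le distrib_right)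
  also have "\<dots> = (\<Sum>k\<le>Suc e. ?h (Suc k) (Suc e - k) * ?N k)"
    by simp
  finally show ?case .
qed

text \<open>
  The divided difference of \<open>t\<^bsup>e\<^esup>\<close> at \<open>x 1, \<dots>, x k\<close>, which is zero as soon as \<open>k > e + 1\<close>. The test
  is explicit because truncated subtraction would give degree \<open>0\<close>, hence the value \<open>1\<close>.
\<close>

definition divided_difference :: "nat \<Rightarrow> nat \<Rightarrow> (nat \<Rightarrow> complex) \<Rightarrow> complex" where
  "divided_difference e k x = (if k \<le> Suc e then complete_hom k (Suc e - k) x else 0)"

text \<open>
  At a node \<open>x i\<close> with \<open>i \<le> m\<close>, the Newton products with more than \<open>m - 1\<close> factors contain the factor
  \<open>x i - x i\<close>; the interpolation sum therefore stops at \<open>m\<close>, whatever the exponent.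
\<close>

lemma power_divided_difference:
  assumes "i \<in> {1..m}"
  shows "x i ^ e = (\<Sum>k=1..m. (\<Prod>l=1..<k. (x i - x l)) * divided_difference e k x)"
proof -
  let ?g = "\<lambda>k. (\<Prod>l=1..<k. (x i - x l)) * divided_difference e k x"
  have zero: "(\<Prod>l=1..<k. (x i - x l)) = 0" if "k \<notin> {1..m}" "k \<ge> 1" for k
    using that assms by (intro prod_zero) (auto intro!: bexI[of _ i])
  have "x i ^ e = (\<Sum>k\<le>e. ?g (Suc k))"
    unfolding power_newton[of "x i" e x] divided_difference_def
    by (intro sum.cong refl) (simp add: atLeastLessThanSuc_atLeastAtMost mult.commute)
  also have "\<dots> = (\<Sum>k=1..Suc e. ?g k)"
    unfolding One_nat_def sum.atLeast1_atMost_eq lessThan_Suc_atMost ..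
  also have "\<dots> = (\<Sum>k\<in>{1..Suc e} \<union> {1..m}. ?g k)"
    by (rule sum.mono_neutral_left) (auto simp: divided_difference_def)
  also have "\<dots> = (\<Sum>k=1..m. ?g k)"
    by (rule sum.mono_neutral_right) (use zero in auto)
  finally show ?thesis .
qed

text \<open>
  Newton interpolation writes the matrix \<open>(x i ^ e j)\<close> as a product of the lower triangular matrix of
  Newton products, of determinant the Vandermonde product, and a matrix of divided differences, whose
  entries are polynomials in \<open>x\<close>. So every alternant is divisible by the Vandermonde product.
\<close>

lemma alternant_factorization:
  "det_on {1..m} {1..m} (\<lambda>i j. x i ^ e j)
   = vandermonde m x * det_on {1..m} {1..m} (\<lambda>k j. divided_difference (e j) k x)"
proof -
  have "det_on {1..m} {1..m} (\<lambda>i j. x i ^ e j) = det_on {1..m} {1..m}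
      (\<lambda>i j. \<Sum>k=1..m. (\<Prod>l=1..<k. (x i - x l)) * divided_difference (e j) k x)"
    by (rule det_on_cong) (auto intro: power_divided_difference)
  also have "\<dots> = det_on {1..m} {1..m} (\<lambda>i k. \<Prod>l=1..<k. (x i - x l))
      * det_on {1..m} {1..m} (\<lambda>k j. divided_difference (e j) k x)"
    by (rule det_on_matrix_mult)
  also have "det_on {1..m} {1..m} (\<lambda>i k. \<Prod>l=1..<k. (x i - x l)) = vandermonde m x"
    unfolding vandermonde_def
    by (rule det_on_lower_triangular) (auto intro!: prod_zero)
  finally show ?thesis .
qed

text \<open>
  The sign of the permutation reversing \<open>{1..m}\<close>, by which the staircase alternant differs from the
  Vandermonde product.
\<close>

definition reversal_sign :: "nat \<Rightarrow> complex" where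
  "reversal_sign m = of_int (sign (\<lambda>i. if i \<in> {1..m} then m + 1 - i else i))"

lemma reversal_sign_square: "reversal_sign m * reversal_sign m = 1"
  unfolding reversal_sign_def of_int_mult[symmetric] by (simp add: sign_idempotent)

text \<open>
  For the staircase exponents, the matrix of divided differences becomes unitriangular once its
  columns are reversed.
\<close>

lemma staircase_alternant:
  "det_on {1..m} {1..m} (\<lambda>i j. x i ^ (m - j)) = reversal_sign m * vandermonde m x"
proof -
  let ?\<rho> = "\<lambda>i. if i \<in> {1..m} then m + 1 - i else i"
  have \<rho>: "?\<rho> permutes {1..m}"
    by (rule bij_imp_permutes, rule bij_betwI[of _ _ _ ?\<rho>]) auto
  have "det_on {1..m} {1..m} (\<lambda>k j. divided_difference (m - j) k x)
      = det_on {1..m} {1..m} (\<lambda>j k. divided_difference (m - j) k x)"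
    by (rule det_on_transpose) simp
  moreover have "reversal_sign m * det_on {1..m} {1..m} (\<lambda>j k. divided_difference (m - j) k x) = 1"
  proof -
    have "reversal_sign m * det_on {1..m} {1..m} (\<lambda>j k. divided_difference (m - j) k x)
        = det_on {1..m} {1..m} (\<lambda>j k. divided_difference (m - ?\<rho> j) k x)"
      unfolding reversal_sign_def by (rule det_on_permute_rows[OF \<rho>, symmetric])
    also have "\<dots> = det_on {1..m} {1..m} (\<lambda>j k. divided_difference (j - 1) k x)"
      by (rule det_on_cong) auto
    also have "\<dots> = (\<Prod>j=1..m. divided_difference (j - 1) j x)"
      by (rule det_on_lower_triangular) (auto simp: divided_difference_def)
    also have "\<dots> = 1"
      by (rule prod.neutral) (auto simp: divided_difference_def)
    finally show ?thesis .
  qed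
  ultimately have "det_on {1..m} {1..m} (\<lambda>k j. divided_difference (m - j) k x) = reversal_sign m"
    using reversal_sign_square[of m] by (metis mult.assoc mult.right_neutral mult_1)
  then show ?thesis
    using alternant_factorization[of m x "\<lambda>j. m - j"] by simp
qed

lemma is_mpoly_divided_difference: "k \<le> m \<Longrightarrow> is_mpoly m (\<lambda>x. divided_difference e k x)"
  by (cases "k \<le> Suc e") (auto simp: divided_difference_def intro: is_mpoly_complete_hom is_mpoly_const)

text \<open>
  The quotient in the definition of the Schur polynomial exists by the factorization of alternants and
  is unique by cancellation of the Vandermonde product, so the definite description denotes it.
\<close>

theorem schur_properties:
  shows is_mpoly_schur: "is_mpoly m (schur m lam)"
    and vandermonde_times_schur: "vandermonde m x * schur m lam x
      = reversal_sign m * det_on {1..m} {1..m} (\<lambda>i j. x i ^ (lam j + m - j))"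
proof -
  let ?P = "\<lambda>s. is_mpoly m s \<and>
     (\<forall>x. s x * det_on {1..m} {1..m} (\<lambda>i j. x i ^ (m - j)) =
          det_on {1..m} {1..m} (\<lambda>i j. x i ^ (lam j + m - j)))"
  let ?D = "\<lambda>x. det_on {1..m} {1..m} (\<lambda>k j. divided_difference (lam j + m - j) k x)"
  have ex: "?P (\<lambda>x. reversal_sign m * ?D x)"
  proof (intro conjI allI)
    show "is_mpoly m (\<lambda>x. reversal_sign m * ?D x)"
      by (intro is_mpoly_mult is_mpoly_const is_mpoly_det_on is_mpoly_divided_difference) simp
    fix x
    show "reversal_sign m * ?D x * det_on {1..m} {1..m} (\<lambda>i j. x i ^ (m - j))
        = det_on {1..m} {1..m} (\<lambda>i j. x i ^ (lam j + m - j))"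
      unfolding staircase_alternant alternant_factorization[of m x "\<lambda>j. lam j + m - j"]
      using reversal_sign_square[of m] by (simp add: mult_ac)
  qed
  have uniq: "s = t" if "?P s" "?P t" for s t
  proof (rule is_mpoly_vandermonde_cancel[of m])
    fix x
    have "reversal_sign m * (s x * vandermonde m x) = reversal_sign m * (t x * vandermonde m x)"
      using that by (simp add: staircase_alternant mult_ac)
    then show "s x * vandermonde m x = t x * vandermonde m x"
      using reversal_sign_square[of m] by auto
  qed (use that in auto)
  have P: "?P (schur m lam)"
    unfolding schur_def by (rule theI[where P = ?P, OF ex]) (rule uniq[OF _ ex])
  then show "is_mpoly m (schur m lam)" by blast
  have "det_on {1..m} {1..m} (\<lambda>i j. x i ^ (lam j + m - j)) = schur m lam x * (reversal_sign m * vandermonde m x)"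
    using P by (simp add: staircase_alternant)
  then have "reversal_sign m * det_on {1..m} {1..m} (\<lambda>i j. x i ^ (lam j + m - j))
      = (reversal_sign m * reversal_sign m) * (vandermonde m x * schur m lam x)"
    by simp
  then show "vandermonde m x * schur m lam x
      = reversal_sign m * det_on {1..m} {1..m} (\<lambda>i j. x i ^ (lam j + m - j))"
    by (simp add: reversal_sign_square)
qed

section \<open>Antisymmetric polynomials and uniqueness of the reproducing kernel\<close>

lemma antisym_space_const_mult:
  "f \<in> antisym_space n m \<Longrightarrow> (\<lambda>x. c * f x) \<in> antisym_space n m"
  unfolding antisym_space_def by (auto intro: mpoly_below_const_mult)

lemma antisym_space_sum:
  "(\<And>a. a \<in> A \<Longrightarrow> f a \<in> antisym_space n m) \<Longrightarrow> (\<lambda>x. \<Sum>a\<in>A. f a x) \<in> antisym_space n m"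
  unfolding antisym_space_def by (auto intro: mpoly_below_sum simp: sum_distrib_left)

text \<open>
  The exponents \<open>f j - 1\<close> for decreasing \<open>f\<close> into \<open>{1..n}\<close> are the \<open>m\<close>-subsets of \<open>{0..<n}\<close>; these
  alternants form the standard basis of the antisymmetric polynomials of degree below \<open>n\<close>.
\<close>

definition alternant :: "nat \<Rightarrow> (nat \<Rightarrow> nat) \<Rightarrow> (nat \<Rightarrow> complex) \<Rightarrow> complex" where
  "alternant m f x = det_on {1..m} {1..m} (\<lambda>i j. x i ^ (f j - 1))"

lemma alternant_in_antisym_space:
  assumes "f \<in> dec_functions m n"
  shows "alternant m f \<in> antisym_space n m"
proof -
  have "mpoly_below n m (alternant m f)"
  proof (rule mpoly_belowI)
    show "alternant m f x = (\<Sum>\<pi> | \<pi> permutes {1..m}. of_int (sign \<pi>) * mono_val m (\<lambda>i. f (\<pi> i) - 1) x)" for x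
      by (simp add: alternant_def det_on_leibniz mono_val_def)
    fix \<pi> i assume "\<pi> \<in> {\<pi>. \<pi> permutes {1..m}}" "i \<in> {1..m}"
    then have "\<pi> i \<in> {1..m}" by (simp only: mem_Collect_eq permutes_in_image)
    then have "f (\<pi> i) \<in> {1..n}" using assms unfolding dec_functions_def by blast
    then show "f (\<pi> i) - 1 < n" by auto
  qed (simp add: finite_permutations)
  moreover have "alternant m f (x \<circ> \<pi>) = of_int (sign \<pi>) * alternant m f x" if "\<pi> permutes {1..m}" for \<pi> x
    using det_on_permute_rows[OF that, of "\<lambda>i j. x i ^ (f j - 1)"] by (simp add: alternant_def)
  ultimately show ?thesis by (simp add: antisym_space_def)
qed

lemma antisym_tensorI:
  assumes "finite A" and G: "\<And>x y. G x y = (\<Sum>a\<in>A. f a x * g a y)"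
    and f: "\<And>a. a \<in> A \<Longrightarrow> f a \<in> antisym_space n m" and g: "\<And>a. a \<in> A \<Longrightarrow> g a \<in> antisym_space n m"
  shows "G \<in> antisym_tensor n m"
proof -
  obtain e where e: "bij_betw e {..<card A} A"
    using ex_bij_betw_nat_finite[OF assms(1)] by (auto simp: lessThan_atLeast0)
  have "G x y = (\<Sum>k<card A. f (e k) x * g (e k) y)" for x y
    unfolding G by (rule sum.reindex_bij_betw[OF e, symmetric])
  moreover have "e k \<in> A" if "k < card A" for k
    using e that by (auto simp: bij_betw_def)
  ultimately show ?thesis
    unfolding antisym_tensor_def using f g
    by (intro CollectI exI[of _ "card A"] exI[of _ "\<lambda>k. f (e k)"] exI[of _ "\<lambda>k. g (e k)"]) blast
qed

lemma antisym_tensor_slice: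
  assumes "G \<in> antisym_tensor n m" shows "G x \<in> antisym_space n m"
proof -
  obtain N :: nat and f g where fg: "\<And>k. k < N \<Longrightarrow> g k \<in> antisym_space n m"
    and G: "\<And>x y. G x y = (\<Sum>k<N. f k x * g k y)"
    using assms unfolding antisym_tensor_def by blast
  have eq: "G x = (\<lambda>y. \<Sum>k<N. f k x * g k y)" using G by blast
  show ?thesis
    unfolding eq using fg by (intro antisym_space_sum antisym_space_const_mult) auto
qed

text \<open>
  Pairing the slices \<open>G x\<close> and \<open>H y\<close> gives \<open>G x y\<close> by the reproducing property of \<open>H\<close>, and \<open>H y x\<close> by
  that of \<open>G\<close>.
\<close>

lemma reproducing_kernel_swap:
  assumes G: "reproducing_kernel L n m G" and H: "reproducing_kernel L n m H"
  shows "G x y = H y x"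
proof -
  have "G x y = multi_functional L m (\<lambda>z. G x z * H y z)"
    using H antisym_tensor_slice[of G n m x] G unfolding reproducing_kernel_def by metis
  also have "\<dots> = multi_functional L m (\<lambda>z. H y z * G x z)"
    by (simp add: mult.commute)
  also have "\<dots> = H y x"
    using G H antisym_tensor_slice[of H n m y] unfolding reproducing_kernel_def by metis
  finally show ?thesis .
qed

text \<open>
  Applying the swap to \<open>H\<close> and itself shows that a reproducing kernel is symmetric.
\<close>

lemma reproducing_kernel_unique:
  assumes "reproducing_kernel L n m G" "reproducing_kernel L n m H"
  shows "G = H"
  using reproducing_kernel_swap[OF assms] reproducing_kernel_swap[OF assms(2) assms(2)]
  by (auto simp: fun_eq_iff)

section \<open>The determinantal reproducing kernel\<close>

lemma functional_sum:
  assumes "Vector_Spaces.linear smult (*) L"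
  shows "L (\<Sum>a\<in>A. smult (c a) (q a)) = (\<Sum>a\<in>A. c a * L (q a))"
proof -
  interpret Vector_Spaces.linear smult "(*)" L by fact
  show ?thesis by (simp add: sum scale)
qed

lemma apply_in_var_poly:
  assumes "\<And>t. f (x(i := t)) = poly q t"
  shows "apply_in_var L i f x = L q"
proof -
  have "(THE q. \<forall>t. poly q t = f (x(i := t))) = q"
    using assms by (intro the_equality) (auto simp: poly_eq_poly_eq_iff[symmetric] fun_eq_iff)
  then show ?thesis by (simp add: apply_in_var_def)
qed

text \<open>
  On sums of products of one-variable polynomials, the iterated functional factorizes. All integrands
  below have this form.
\<close>

lemma apply_in_vars_separated:
  assumes lin: "Vector_Spaces.linear smult (*) L"
  shows "apply_in_vars L k (\<lambda>y. \<Sum>a\<in>A. c a * (\<Prod>i=1..k. poly (q a i) (y i))) x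
    = (\<Sum>a\<in>A. c a * (\<Prod>i=1..k. L (q a i)))"
proof (induction k arbitrary: c)
  case 0
  show ?case by simp
next
  case (Suc k)
  let ?f = "\<lambda>y. \<Sum>a\<in>A. c a * (\<Prod>i=1..Suc k. poly (q a i) (y i))"
  have "apply_in_var L (Suc k) ?f = (\<lambda>y. \<Sum>a\<in>A. (c a * L (q a (Suc k))) * (\<Prod>i=1..k. poly (q a i) (y i)))"
  proof
    fix y
    let ?q = "\<Sum>a\<in>A. smult (c a * (\<Prod>i=1..k. poly (q a i) (y i))) (q a (Suc k))"
    have "apply_in_var L (Suc k) ?f y = L ?q"
    proof (rule apply_in_var_poly)
      fix t
      have "(\<Prod>i=1..k. poly (q a i) ((y(Suc k := t)) i)) = (\<Prod>i=1..k. poly (q a i) (y i))" for a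
        by (rule prod.cong) auto
      then show "?f (y(Suc k := t)) = poly ?q t"
        by (simp add: poly_sum mult.assoc)
    qed
    then show "apply_in_var L (Suc k) ?f y
        = (\<Sum>a\<in>A. (c a * L (q a (Suc k))) * (\<Prod>i=1..k. poly (q a i) (y i)))"
      by (simp add: functional_sum[OF lin] mult_ac)
  qed
  then have "apply_in_vars L (Suc k) ?f x
      = apply_in_vars L k (\<lambda>y. \<Sum>a\<in>A. (c a * L (q a (Suc k))) * (\<Prod>i=1..k. poly (q a i) (y i))) x"
    by simp
  also have "\<dots> = (\<Sum>a\<in>A. (c a * L (q a (Suc k))) * (\<Prod>i=1..k. L (q a i)))"
    by (rule Suc.IH)
  finally show ?case by (simp add: mult_ac)
qed

abbreviation (input) hankel :: "(complex poly \<Rightarrow> complex) \<Rightarrow> nat \<Rightarrow> nat \<Rightarrow> complex" where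
  "hankel L i j \<equiv> moment L (i + j - 2)"

definition bilinear_kernel :: "nat \<Rightarrow> (nat \<Rightarrow> nat \<Rightarrow> complex) \<Rightarrow> complex \<Rightarrow> complex \<Rightarrow> complex" where
  "bilinear_kernel n B u v = (\<Sum>a=1..n. u ^ (a - 1) * (\<Sum>b=1..n. B a b * v ^ (b - 1)))"

text \<open>
  The same kernel as a polynomial in its second variable, to which the functional applies.
\<close>

definition kernel_poly :: "nat \<Rightarrow> (nat \<Rightarrow> nat \<Rightarrow> complex) \<Rightarrow> complex \<Rightarrow> complex poly" where
  "kernel_poly n B u = (\<Sum>(a, b)\<in>{1..n} \<times> {1..n}. smult (u ^ (a - 1) * B a b) (monom 1 (b - 1)))"

lemma poly_kernel_poly: "poly (kernel_poly n B u) v = bilinear_kernel n B u v"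
  unfolding kernel_poly_def bilinear_kernel_def
  by (simp add: poly_sum sum.cartesian_product sum_distrib_left mult.assoc poly_monom
      case_prod_unfold)

text \<open>
  The functional of \<open>v\<^bsup>e\<^esup> v\<^bsup>b-1\<^esup>\<close> is the Hankel entry at \<open>(b, e + 1)\<close>, so the coefficient of \<open>u\<^bsup>a-1\<^esup>\<close> is
  the entry of the left inverse times the Hankel matrix at \<open>(a, e + 1)\<close>.
\<close>

lemma kernel_poly_reproduces:
  assumes lin: "Vector_Spaces.linear smult (*) L"
    and inv: "\<And>r c. r \<in> {1..n} \<Longrightarrow> c \<in> {1..n} \<Longrightarrow> (\<Sum>b=1..n. B r b * hankel L b c) = (if r = c then 1 else 0)"
    and e: "e < n"
  shows "L (monom 1 e * kernel_poly n B u) = u ^ e"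
proof -
  have "monom 1 e * kernel_poly n B u
      = (\<Sum>p\<in>{1..n} \<times> {1..n}. smult (u ^ (fst p - 1) * B (fst p) (snd p)) (monom 1 (e + (snd p - 1))))"
    by (simp add: kernel_poly_def sum_distrib_left case_prod_unfold mult_monom)
  then have "L (monom 1 e * kernel_poly n B u)
      = (\<Sum>p\<in>{1..n} \<times> {1..n}. u ^ (fst p - 1) * B (fst p) (snd p) * moment L (e + (snd p - 1)))"
    by (simp only: functional_sum[OF lin] moment_def)
  also have "\<dots> = (\<Sum>a=1..n. \<Sum>b=1..n. u ^ (a - 1) * B a b * moment L (e + (b - 1)))"
    unfolding sum.cartesian_product case_prod_unfold ..
  also have "\<dots> = (\<Sum>a=1..n. u ^ (a - 1) * (\<Sum>b=1..n. B a b * hankel L b (Suc e)))"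
    unfolding sum_distrib_left
  proof (intro sum.cong refl)
    fix b assume "b \<in> {1..n}"
    then have "e + (b - 1) = b + Suc e - 2" by auto
    then show "u ^ (a - 1) * B a b * moment L (e + (b - 1)) = u ^ (a - 1) * (B a b * hankel L b (Suc e))" for a
      by simp
  qed
  also have "\<dots> = (\<Sum>a=1..n. if a = Suc e then u ^ (a - 1) else 0)"
    by (intro sum.cong refl, subst inv) (use e in auto)
  also have "\<dots> = u ^ e" using e by simp
  finally show ?thesis .
qed

text \<open>
  In the Leibniz term of \<open>\<pi>\<close>, reproduction in each variable separately turns \<open>f\<close> into \<open>f (x \<circ> \<pi>)\<close>. By
  antisymmetry its sign cancels the sign of the term, so all \<open>m!\<close> terms equal \<open>f x\<close>.
\<close>

lemma det_kernel_reproduces: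
  assumes lin: "Vector_Spaces.linear smult (*) L"
    and inv: "\<And>r c. r \<in> {1..n} \<Longrightarrow> c \<in> {1..n} \<Longrightarrow> (\<Sum>b=1..n. B r b * hankel L b c) = (if r = c then 1 else 0)"
    and f: "f \<in> antisym_space n m"
  shows "f x = multi_functional L m (\<lambda>y. f y * det_on {1..m} {1..m} (\<lambda>i j. bilinear_kernel n B (x i) (y j)))"
proof -
  let ?E = "{1..m} \<rightarrow>\<^sub>E {..<n}" and ?P = "{\<pi>. \<pi> permutes {1..m}}"
  obtain a where a: "\<And>x. f x = (\<Sum>\<alpha>\<in>?E. a \<alpha> * mono_val m \<alpha> x)"
    using f unfolding antisym_space_def mpoly_below_def by blast
  have anti: "f (x \<circ> \<pi>) = of_int (sign \<pi>) * f x" if "\<pi> \<in> ?P" for \<pi>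
    using f that unfolding antisym_space_def by blast
  define q where "q = (\<lambda>(\<alpha>, \<pi>) (i::nat). monom 1 (\<alpha> i) * kernel_poly n B (x (\<pi> i)))"
  define c where "c = (\<lambda>(\<alpha>, \<pi> :: nat \<Rightarrow> nat). a \<alpha> * of_int (sign \<pi>))"
  have expand: "f y * det_on {1..m} {1..m} (\<lambda>i j. bilinear_kernel n B (x i) (y j))
     = (\<Sum>s\<in>?E \<times> ?P. c s * (\<Prod>i=1..m. poly (q s i) (y i)))" for y
  proof -
    have "det_on {1..m} {1..m} (\<lambda>i j. bilinear_kernel n B (x i) (y j))
        = det_on {1..m} {1..m} (\<lambda>i j. bilinear_kernel n B (x j) (y i))"
      by (rule det_on_transpose[symmetric]) simp
    moreover have "f y * det_on {1..m} {1..m} (\<lambda>i j. bilinear_kernel n B (x j) (y i))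
        = (\<Sum>s\<in>?E \<times> ?P. c s * (\<Prod>i=1..m. poly (q s i) (y i)))"
      unfolding a det_on_leibniz sum_product sum.cartesian_product
      by (intro sum.cong refl)
        (simp add: c_def q_def mono_val_def prod.distrib poly_monom poly_kernel_poly case_prod_unfold)
    ultimately show ?thesis by simp
  qed
  have "multi_functional L m (\<lambda>y. f y * det_on {1..m} {1..m} (\<lambda>i j. bilinear_kernel n B (x i) (y j)))
      = (\<Sum>s\<in>?E \<times> ?P. c s * (\<Prod>i=1..m. L (q s i))) / fact m"
    unfolding multi_functional_def expand apply_in_vars_separated[OF lin] ..
  also have "(\<Sum>s\<in>?E \<times> ?P. c s * (\<Prod>i=1..m. L (q s i)))
      = (\<Sum>(\<alpha>, \<pi>)\<in>?E \<times> ?P. of_int (sign \<pi>) * (a \<alpha> * mono_val m \<alpha> (x \<circ> \<pi>)))"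
  proof (intro sum.cong refl)
    fix s assume "s \<in> ?E \<times> ?P"
    then obtain \<alpha> \<pi> where s: "s = (\<alpha>, \<pi>)" and "\<alpha> \<in> ?E" by auto
    then have "L (q (\<alpha>, \<pi>) i) = x (\<pi> i) ^ \<alpha> i" if "i \<in> {1..m}" for i
      unfolding q_def using kernel_poly_reproduces[OF lin inv exponent_less] that by simp
    then show "c s * (\<Prod>i=1..m. L (q s i))
        = (case s of (\<alpha>, \<pi>) \<Rightarrow> of_int (sign \<pi>) * (a \<alpha> * mono_val m \<alpha> (x \<circ> \<pi>)))"
      by (simp add: s c_def mono_val_def)
  qed
  also have "\<dots> = (\<Sum>\<pi>\<in>?P. of_int (sign \<pi>) * f (x \<circ> \<pi>))"
    unfolding sum.cartesian_product[symmetric] by (subst sum.swap) (simp only: a sum_distrib_left)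
  also have "\<dots> = (\<Sum>\<pi>\<in>?P. f x)"
  proof (intro sum.cong refl)
    fix \<pi> assume "\<pi> \<in> ?P"
    have "of_int (sign \<pi>) * of_int (sign \<pi>) = (1 :: complex)"
      unfolding of_int_mult[symmetric] by (simp add: sign_idempotent)
    then show "of_int (sign \<pi>) * f (x \<circ> \<pi>) = f x"
      using anti[OF \<open>\<pi> \<in> ?P\<close>] by (simp add: mult.assoc[symmetric])
  qed
  also have "\<dots> = fact m * f x"
    by (simp add: card_permutations)
  finally show ?thesis by simp
qed

section \<open>The Hankel matrix of moments\<close>

lemma poly_as_shifted_sum:
  assumes "degree f < n" shows "(\<Sum>k=1..n. smult (coeff f (k - 1)) (monom 1 (k - 1))) = (f :: complex poly)"
proof (rule poly_eqI)
  fix d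
  have "coeff (\<Sum>k=1..n. smult (coeff f (k - 1)) (monom 1 (k - 1))) d
      = (\<Sum>k=1..n. if k = Suc d then coeff f d else 0)"
    unfolding coeff_sum by (intro sum.cong refl) auto
  also have "\<dots> = coeff f d"
    using assms by (auto simp: coeff_eq_0)
  finally show "coeff (\<Sum>k=1..n. smult (coeff f (k - 1)) (monom 1 (k - 1))) d = coeff f d" .
qed

lemma functional_mult_hankel:
  assumes lin: "Vector_Spaces.linear smult (*) L" and "degree f < n" "degree g < n"
  shows "L (f * g) = (\<Sum>k=1..n. coeff f (k - 1) * (\<Sum>l=1..n. hankel L k l * coeff g (l - 1)))"
proof -
  have "f * g = (\<Sum>k=1..n. smult (coeff f (k - 1)) (monom 1 (k - 1)))
      * (\<Sum>l=1..n. smult (coeff g (l - 1)) (monom 1 (l - 1)))"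
    using assms by (simp only: poly_as_shifted_sum)
  also have "\<dots> = (\<Sum>p\<in>{1..n} \<times> {1..n}. smult (coeff f (fst p - 1) * coeff g (snd p - 1))
      (monom 1 ((fst p - 1) + (snd p - 1))))"
    unfolding sum_product sum.cartesian_product case_prod_unfold
    by (intro sum.cong refl) (simp add: mult_monom mult.commute)
  finally have "L (f * g) = (\<Sum>p\<in>{1..n} \<times> {1..n}. coeff f (fst p - 1) * coeff g (snd p - 1)
      * moment L ((fst p - 1) + (snd p - 1)))"
    by (simp only: functional_sum[OF lin] moment_def)
  also have "\<dots> = (\<Sum>k=1..n. \<Sum>l=1..n. coeff f (k - 1) * (hankel L k l * coeff g (l - 1)))"
    unfolding sum.cartesian_product case_prod_unfold
  proof (intro sum.cong refl)
    fix p assume "p \<in> {1..n} \<times> {1..n}"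
    then have "(fst p - 1) + (snd p - 1) = fst p + snd p - 2" by auto
    then show "coeff f (fst p - 1) * coeff g (snd p - 1) * moment L ((fst p - 1) + (snd p - 1))
      = coeff f (fst p - 1) * (hankel L (fst p) (snd p) * coeff g (snd p - 1))"
      by (simp add: mult_ac)
  qed
  finally show ?thesis by (simp add: sum_distrib_left)
qed

text \<open>
  With \<open>P\<close> the coefficient matrix of the orthogonal polynomials, \<open>P H P\<^sup>T\<close> is the diagonal matrix of the
  norms, and \<open>P\<close> is lower triangular with ones on the diagonal because the polynomials are monic.
\<close>

lemma det_hankel:
  assumes lin: "Vector_Spaces.linear smult (*) L" and p: "monic_orthogonal L p"
  shows "det_on {1..n} {1..n} (hankel L) = (\<Prod>i=1..n. L (p (i - 1) * p (i - 1)))"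
proof -
  let ?P = "\<lambda>i k. coeff (p (i - 1)) (k - 1)"
  have deg: "degree (p k) = k" "lead_coeff (p k) = 1" for k
    using p unfolding monic_orthogonal_def by blast+
  have orth: "j \<noteq> k \<Longrightarrow> L (p j * p k) = 0" for j k
    using p unfolding monic_orthogonal_def by blast
  have detP: "det_on {1..n} {1..n} ?P = 1"
  proof -
    have "det_on {1..n} {1..n} ?P = (\<Prod>i=1..n. ?P i i)"
      by (rule det_on_lower_triangular) (auto simp: coeff_eq_0 deg)
    also have "\<dots> = 1" using deg by (intro prod.neutral) metis
    finally show ?thesis .
  qed
  have "det_on {1..n} {1..n} (\<lambda>i j. L (p (i - 1) * p (j - 1)))
      = det_on {1..n} {1..n} (\<lambda>i j. \<Sum>k=1..n. ?P i k * (\<Sum>l=1..n. hankel L k l * ?P j l))"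
    by (intro det_on_cong functional_mult_hankel lin) (auto simp: deg)
  also have "\<dots> = det_on {1..n} {1..n} ?P * det_on {1..n} {1..n} (\<lambda>k j. \<Sum>l=1..n. hankel L k l * ?P j l)"
    by (rule det_on_matrix_mult)
  also have "det_on {1..n} {1..n} (\<lambda>k j. \<Sum>l=1..n. hankel L k l * ?P j l)
      = det_on {1..n} {1..n} (hankel L) * det_on {1..n} {1..n} (\<lambda>l j. ?P j l)"
    by (rule det_on_matrix_mult)
  also have "det_on {1..n} {1..n} (\<lambda>l j. ?P j l) = det_on {1..n} {1..n} ?P"
    by (rule det_on_transpose) simp
  finally have "det_on {1..n} {1..n} (hankel L) = det_on {1..n} {1..n} (\<lambda>i j. L (p (i - 1) * p (j - 1)))"
    by (simp add: detP)
  also have "\<dots> = (\<Prod>i=1..n. L (p (i - 1) * p (i - 1)))"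
    by (rule det_on_lower_triangular) (auto intro!: orth)
  finally show ?thesis .
qed

text \<open>
  A kernel vector of the Hankel matrix is the coefficient vector of a polynomial of degree below \<open>n\<close>
  that is orthogonal to all polynomials of degree below \<open>n\<close>.
\<close>

lemma det_hankel_nonzero:
  assumes lin: "Vector_Spaces.linear smult (*) L" and nd: "nondegenerate_functional L"
  shows "det_on {1..n} {1..n} (hankel L) \<noteq> 0"
proof
  let ?H = "mat n n (\<lambda>(i, j). hankel L (Suc i) (Suc j))"
  assume "det_on {1..n} {1..n} (hankel L) = 0"
  then have "det ?H = 0" by (simp only: det_on_interval)
  then obtain v where v: "v \<in> carrier_vec n" "v \<noteq> 0\<^sub>v n" "?H *\<^sub>v v = 0\<^sub>v n"
    using det_0_iff_vec_prod_zero_field[of ?H n] by auto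
  have n: "n \<ge> 1" using v by (cases n) auto
  define f where "f = (\<Sum>k=1..n. smult (v $ (k - 1)) (monom 1 (k - 1)))"
  have coeff_f: "coeff f d = (if d < n then v $ d else 0)" for d
  proof -
    have "coeff f d = (\<Sum>k=1..n. if k = Suc d then v $ d else 0)"
      unfolding f_def coeff_sum by (intro sum.cong refl) auto
    then show ?thesis by auto
  qed
  have deg: "degree f \<le> n - 1"
    by (rule degree_le) (use n in \<open>auto simp: coeff_f\<close>)
  have "L (f * g) = 0" if "degree g \<le> n - 1" for g
  proof -
    have "L (g * f) = (\<Sum>k=1..n. coeff g (k - 1) * (\<Sum>l=1..n. hankel L k l * coeff f (l - 1)))"
      using that deg n by (intro functional_mult_hankel[OF lin]) auto
    also have "\<dots> = 0"
    proof (rule sum.neutral, rule ballI)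
      fix k assume k: "k \<in> {1..n}"
      have "(\<Sum>l=1..n. hankel L k l * coeff f (l - 1)) = (\<Sum>l=0..<n. hankel L k (Suc l) * v $ l)"
        by (simp add: One_nat_def sum.atLeast1_atMost_eq lessThan_atLeast0 coeff_f)
      also have "\<dots> = (?H *\<^sub>v v) $ (k - 1)"
        using k v(1) by (auto simp: scalar_prod_def)
      also have "\<dots> = 0" using k unfolding v(3) by (subst index_zero_vec(1)) auto
      finally show "coeff g (k - 1) * (\<Sum>l=1..n. hankel L k l * coeff f (l - 1)) = 0"
        by simp
    qed
    finally show ?thesis by (simp add: mult.commute)
  qed
  then have "f = 0"
    by (rule nd[unfolded nondegenerate_functional_def, rule_format, OF n deg])
  then have "v $ d = 0" if "d < n" for d using coeff_f[of d] that by simp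
  then have "v = 0\<^sub>v n" using v(1) by (intro eq_vecI) auto
  then show False using v(2) by contradiction
qed

lemma inverse_matrix_exists:
  assumes "det_on {1..n} {1..n} H \<noteq> 0"
  obtains B where
    "\<And>r c. r \<in> {1..n} \<Longrightarrow> c \<in> {1..n} \<Longrightarrow> (\<Sum>b=1..n. H r b * B b c) = (if r = c then 1 else 0)"
    "\<And>r c. r \<in> {1..n} \<Longrightarrow> c \<in> {1..n} \<Longrightarrow> (\<Sum>b=1..n. B r b * H b c) = (if r = c then 1 else 0)"
proof -
  let ?H = "mat n n (\<lambda>(i, j). H (Suc i) (Suc j))"
  have H: "?H \<in> carrier_mat n n" by simp
  have d: "det ?H \<noteq> 0" using assms by (simp only: det_on_interval not_False_eq_True)
  define B where "B r c = adj_mat ?H $$ (r - 1, c - 1) / det ?H" for r c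
  have adj: "adj_mat ?H \<in> carrier_mat n n" by (rule adj_mat(1)[OF H])
  have shift: "(\<Sum>b=1..n. g b) = (\<Sum>b=0..<n. g (Suc b))" for g :: "nat \<Rightarrow> complex"
    by (simp add: One_nat_def sum.atLeast1_atMost_eq lessThan_atLeast0)
  show ?thesis
  proof (rule that[of B])
    fix r c assume rc: "r \<in> {1..n}" "c \<in> {1..n}"
    then have le: "r - 1 < n" "c - 1 < n" "r - 1 = c - 1 \<longleftrightarrow> r = c" "Suc (r - 1) = r" "Suc (c - 1) = c" by auto
    have "(\<Sum>b=1..n. H r b * B b c) = (?H * adj_mat ?H) $$ (r - 1, c - 1) / det ?H"
      using le adj unfolding shift B_def by (simp add: scalar_prod_def sum_divide_distrib)
    then show "(\<Sum>b=1..n. H r b * B b c) = (if r = c then 1 else 0)"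
      using le d unfolding adj_mat(2)[OF H] by simp
    have "(\<Sum>b=1..n. B r b * H b c) = (adj_mat ?H * ?H) $$ (r - 1, c - 1) / det ?H"
      using le adj unfolding shift B_def by (simp add: scalar_prod_def sum_divide_distrib)
    then show "(\<Sum>b=1..n. B r b * H b c) = (if r = c then 1 else 0)"
      using le d unfolding adj_mat(3)[OF H] by simp
  qed
qed

section \<open>Partitions in a box and the expansion of the kernel\<close>

definition shifted_parts :: "nat \<Rightarrow> (nat \<Rightarrow> nat) \<Rightarrow> nat \<Rightarrow> nat" where
  "shifted_parts m lam = (\<lambda>k\<in>{1..m}. lam k + m + 1 - k)"

text \<open>
  Strict decrease of integers means decrease by at least the distance of the arguments. This keeps the
  subtraction in the inverse of the shift from truncating and bounds the parts by \<open>n - m\<close>.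
\<close>

lemma dec_functions_gap:
  assumes f: "f \<in> dec_functions m n" and "i \<in> {1..m}" "j \<in> {1..m}" "i \<le> j"
  shows "f j + (j - i) \<le> f i"
  using \<open>i \<le> j\<close> \<open>j \<in> {1..m}\<close>
proof (induction j rule: dec_induct)
  case base
  show ?case by simp
next
  case (step j)
  then have "j \<in> {1..m}" using assms(2) by auto
  then have "f (Suc j) < f j" using step f unfolding dec_functions_def by auto
  then show ?case using step \<open>j \<in> {1..m}\<close> by auto
qed

lemma bij_betw_shifted_parts:
  assumes "m \<le> n"
  shows "bij_betw (shifted_parts m) (box_partitions m (n - m)) (dec_functions m n)"
proof (rule bij_betwI[of _ _ _ "\<lambda>f. \<lambda>k\<in>{1..m}. f k + k - (m + 1)"])
  show "shifted_parts m \<in> box_partitions m (n - m) \<rightarrow> dec_functions m n"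
  proof
    fix lam assume "lam \<in> box_partitions m (n - m)"
    then have bound: "lam k \<le> n - m" and anti: "k \<le> l \<Longrightarrow> lam l \<le> lam k"
      if "k \<in> {1..m}" "l \<in> {1..m}" for k l
      using that unfolding box_partitions_def by (auto dest!: PiE_mem[where x = k])
    have "shifted_parts m lam \<in> {1..m} \<rightarrow>\<^sub>E {1..n}"
    proof (rule PiE_I)
      fix k assume "k \<in> {1..m}"
      then show "shifted_parts m lam k \<in> {1..n}"
        using bound[of k k] assms by (auto simp: shifted_parts_def)
    next
      fix k assume "k \<notin> {1..m}"
      then show "shifted_parts m lam k = undefined" by (auto simp: shifted_parts_def)
    qed
    moreover have "shifted_parts m lam j < shifted_parts m lam i"
      if "i \<in> {1..m}" "j \<in> {1..m}" "i < j" for i j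
      using that anti[of i j] by (auto simp: shifted_parts_def)
    ultimately show "shifted_parts m lam \<in> dec_functions m n"
      unfolding dec_functions_def by blast
  qed
  show "(\<lambda>f. \<lambda>k\<in>{1..m}. f k + k - (m + 1)) \<in> dec_functions m n \<rightarrow> box_partitions m (n - m)"
  proof
    fix f assume f: "f \<in> dec_functions m n"
    let ?lam = "\<lambda>k\<in>{1..m}. f k + k - (m + 1)"
    have le: "?lam k \<le> n - m" if k: "k \<in> {1..m}" for k
    proof -
      have "f 1 \<in> {1..n}" using f k unfolding dec_functions_def by (auto dest!: PiE_mem[where x = 1])
      then show ?thesis using dec_functions_gap[OF f, of 1 k] k by auto
    qed
    have "?lam j \<le> ?lam i" if "i \<in> {1..m}" "j \<in> {1..m}" "i \<le> j" for i j
      using dec_functions_gap[OF f that] that by auto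
    moreover have "?lam \<in> {1..m} \<rightarrow>\<^sub>E {0..n - m}"
      using le by (intro PiE_I) auto
    ultimately show "?lam \<in> box_partitions m (n - m)"
      unfolding box_partitions_def by blast
  qed
  show "(\<lambda>k\<in>{1..m}. shifted_parts m lam k + k - (m + 1)) = lam"
    if "lam \<in> box_partitions m (n - m)" for lam
  proof
    fix k
    show "(\<lambda>k\<in>{1..m}. shifted_parts m lam k + k - (m + 1)) k = lam k"
    proof (cases "k \<in> {1..m}")
      case True
      then show ?thesis by (auto simp: shifted_parts_def)
    next
      case False
      have "lam \<in> {1..m} \<rightarrow>\<^sub>E {0..n - m}" using that unfolding box_partitions_def by blast
      from PiE_arb[OF this False] False show ?thesis by (simp only: restrict_apply if_False)
    qed
  qed
  show "shifted_parts m (\<lambda>k\<in>{1..m}. f k + k - (m + 1)) = f" if f: "f \<in> dec_functions m n" for f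
  proof
    fix k
    show "shifted_parts m (\<lambda>k\<in>{1..m}. f k + k - (m + 1)) k = f k"
    proof (cases "k \<in> {1..m}")
      case True
      have "f m \<in> {1..n}" using f True unfolding dec_functions_def by (auto dest!: PiE_mem[where x = m])
      then show ?thesis using dec_functions_gap[OF f, of k m] True by (auto simp: shifted_parts_def)
    next
      case False
      have "f \<in> {1..m} \<rightarrow>\<^sub>E {1..n}" using f unfolding dec_functions_def by blast
      from PiE_arb[OF this False] False show ?thesis
        unfolding shifted_parts_def by (simp only: restrict_apply if_False)
    qed
  qed
qed

lemma finite_box_partitions: "finite (box_partitions m r)"
  unfolding box_partitions_def
  by (rule finite_subset[of _ "{1..m} \<rightarrow>\<^sub>E {0..r}"]) (auto simp: finite_PiE)

lemma index_set_eq: "index_set m lam = shifted_parts m lam ` {1..m}"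
  by (auto simp: index_set_def shifted_parts_def image_iff)

lemma sum_shifted_parts:
  "(\<Sum>i=1..m. shifted_parts m lam i) = (\<Sum>i=1..m. lam i) + (\<Sum>i=1..m. m + 1 - i)"
  unfolding sum.distrib[symmetric] by (rule sum.cong) (auto simp: shifted_parts_def)

lemma vandermonde_schur_alternant:
  "vandermonde m x * schur m lam x = reversal_sign m * alternant m (shifted_parts m lam) x"
  unfolding vandermonde_times_schur alternant_def
  by (intro arg_cong2[of _ _ _ _ "(*)"] refl det_on_cong) (auto simp: shifted_parts_def)

text \<open>
  Cauchy--Binet separates the variables \<open>x\<close> from the kernel and then the variables \<open>y\<close>; what remains are
  the minors of \<open>B\<close>, to which Jacobi's theorem applies. Symmetry of the Hankel matrix exchanges the two
  complements.
\<close>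

lemma det_kernel_expansion:
  assumes inv: "\<And>r c. r \<in> {1..n} \<Longrightarrow> c \<in> {1..n} \<Longrightarrow> (\<Sum>b=1..n. hankel L r b * B b c) = (if r = c then 1 else 0)"
    and D: "det_on {1..n} {1..n} (hankel L) = D" "D \<noteq> 0" and mn: "m \<le> n"
  shows "det_on {1..m} {1..m} (\<lambda>i j. bilinear_kernel n B (x i) (y j))
    = (\<Sum>f\<in>dec_functions m n. \<Sum>h\<in>dec_functions m n.
        (-1) ^ (\<Sum>i=1..m. f i + h i) / D
        * det_on ({1..n} - f ` {1..m}) ({1..n} - h ` {1..m}) (hankel L)
        * alternant m f x * alternant m h y)"
proof -
  have minor: "det_on {1..m} {1..m} (\<lambda>k l. B (f k) (h l)) = (-1) ^ (\<Sum>i=1..m. f i + h i) / D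
      * det_on ({1..n} - f ` {1..m}) ({1..n} - h ` {1..m}) (hankel L)"
    if f: "f \<in> dec_functions m n" and h: "h \<in> dec_functions m n" for f h
  proof -
    have card: "card ({1..n} - e ` {1..m}) = n - m" if e: "e \<in> dec_functions m n" for e
    proof -
      have "e ` {1..m} \<subseteq> {1..n}" using e unfolding dec_functions_def by auto
      then show ?thesis using dec_functions_inj_on[OF e] by (simp add: card_Diff_subset card_image)
    qed
    have "det_on ({1..n} - f ` {1..m}) ({1..n} - h ` {1..m}) (hankel L)
        = det_on ({1..n} - f ` {1..m}) ({1..n} - h ` {1..m}) (\<lambda>i j. hankel L j i)"
      by (simp add: add.commute)
    also have "\<dots> = det_on ({1..n} - h ` {1..m}) ({1..n} - f ` {1..m}) (hankel L)"
      by (rule det_on_transpose) (simp add: card f h)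
    finally show ?thesis
      using jacobi_complementary_minor[OF f h mn inv] D by (simp add: field_simps)
  qed
  have "det_on {1..m} {1..m} (\<lambda>i j. bilinear_kernel n B (x i) (y j))
      = (\<Sum>f\<in>dec_functions m n. alternant m f x
          * det_on {1..m} {1..m} (\<lambda>k j. \<Sum>b=1..n. B (f k) b * y j ^ (b - 1)))"
    unfolding bilinear_kernel_def alternant_def by (rule cauchy_binet)
  also have "\<dots> = (\<Sum>f\<in>dec_functions m n. alternant m f x * (\<Sum>h\<in>dec_functions m n.
      det_on {1..m} {1..m} (\<lambda>k l. B (f k) (h l)) * alternant m h y))"
  proof (intro sum.cong refl arg_cong2[of _ _ _ _ "(*)"])
    fix f
    have "det_on {1..m} {1..m} (\<lambda>l j. y j ^ (h l - 1)) = alternant m h y" for h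
      unfolding alternant_def by (rule det_on_transpose) simp
    then show "det_on {1..m} {1..m} (\<lambda>k j. \<Sum>b=1..n. B (f k) b * y j ^ (b - 1))
        = (\<Sum>h\<in>dec_functions m n. det_on {1..m} {1..m} (\<lambda>k l. B (f k) (h l)) * alternant m h y)"
      using cauchy_binet[where P = "\<lambda>k b. B (f k) b" and n = n and m = m and Q = "\<lambda>b j. y j ^ (b - 1)"] by simp
  qed
  finally show ?thesis
    by (simp add: sum_distrib_left minor mult_ac)
qed

theorem proposition5:
  fixes L :: "complex poly \<Rightarrow> complex" and p :: "nat \<Rightarrow> complex poly" and n m :: nat
    and x y :: "nat \<Rightarrow> complex"
  assumes "Vector_Spaces.linear smult (*) L"
    and "nondegenerate_functional L"
    and "monic_orthogonal L p"
    and "m \<le> n"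
  shows "CD_kernel L n m x y =
    (\<Sum>lam\<in>box_partitions m (n - m). \<Sum>mu\<in>box_partitions m (n - m).
       (-1) ^ (\<Sum>i=1..m. lam i + mu i) / (\<Prod>i=1..n. L (p (i - 1) * p (i - 1))) *
       det_on ({1..n} - index_set m lam) ({1..n} - index_set m mu) (\<lambda>i j. moment L (i + j - 2)) *
       schur m lam x * schur m mu y)"
proof -
  define D where "D = (\<Prod>i=1..n. L (p (i - 1) * p (i - 1)))"
  have D: "det_on {1..n} {1..n} (hankel L) = D"
    unfolding D_def by (rule det_hankel[OF assms(1,3)])
  have D0: "D \<noteq> 0" using det_hankel_nonzero[OF assms(1,2), of n] unfolding D .
  obtain B where
    inv1: "\<And>r c. r \<in> {1..n} \<Longrightarrow> c \<in> {1..n} \<Longrightarrow> (\<Sum>b=1..n. hankel L r b * B b c) = (if r = c then 1 else 0)" and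
    inv2: "\<And>r c. r \<in> {1..n} \<Longrightarrow> c \<in> {1..n} \<Longrightarrow> (\<Sum>b=1..n. B r b * hankel L b c) = (if r = c then 1 else 0)"
    by (rule inverse_matrix_exists[of n "hankel L", unfolded D, OF D0]) blast
  let ?P = "box_partitions m (n - m)" and ?s = "shifted_parts m"
  define coef where "coef lam mu = (-1) ^ (\<Sum>i=1..m. lam i + mu i) / D
    * det_on ({1..n} - index_set m lam) ({1..n} - index_set m mu) (hankel L)" for lam mu
  define K where "K = (\<lambda>x y. \<Sum>lam\<in>?P. \<Sum>mu\<in>?P. coef lam mu * schur m lam x * schur m mu y)"
  \<comment> \<open>The candidate kernel \<open>G\<close> has two descriptions: as a sum of products of alternants it lies in the tensor square of the antisymmetric polynomials, and as the determinant it reproduces.\<close>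
  define G where "G = (\<lambda>x y. vandermonde m x * vandermonde m y * K x y)"
  have s: "?s lam \<in> dec_functions m n" if "lam \<in> ?P" for lam
    using bij_betw_shifted_parts[OF assms(4)] that by (auto simp: bij_betw_def)
  have G_alternants: "G x y = (\<Sum>lam\<in>?P. \<Sum>mu\<in>?P. coef lam mu * alternant m (?s lam) x * alternant m (?s mu) y)"
    for x y
  proof -
    have "vandermonde m x * vandermonde m y * (coef lam mu * schur m lam x * schur m mu y)
        = coef lam mu * alternant m (?s lam) x * alternant m (?s mu) y" for lam mu
    proof -
      have "vandermonde m x * vandermonde m y * (coef lam mu * schur m lam x * schur m mu y)
        = coef lam mu * (vandermonde m x * schur m lam x) * (vandermonde m y * schur m mu y)"
        by (simp only: mult_ac)
      also have "\<dots> = (reversal_sign m * reversal_sign m)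
          * (coef lam mu * alternant m (?s lam) x * alternant m (?s mu) y)"
        unfolding vandermonde_schur_alternant by (simp only: mult_ac)
      finally show ?thesis by (simp add: reversal_sign_square)
    qed
    then show ?thesis unfolding G_def K_def sum_distrib_left by (simp only:)
  qed
  have G_det: "G x y = det_on {1..m} {1..m} (\<lambda>i j. bilinear_kernel n B (x i) (y j))" for x y
  proof -
    let ?t = "\<lambda>f h. (-1) ^ (\<Sum>i=1..m. f i + h i) / D
        * det_on ({1..n} - f ` {1..m}) ({1..n} - h ` {1..m}) (hankel L)
        * alternant m f x * alternant m h y"
    \<comment> \<open>The shifts \<open>m + 1 - i\<close> occur for both partitions, so they leave the parity unchanged.\<close>
    have "(-1 :: complex) ^ (\<Sum>i=1..m. ?s lam i + ?s mu i) = (-1) ^ (\<Sum>i=1..m. lam i + mu i)" for lam mu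
    proof -
      have "(\<Sum>i=1..m. ?s lam i + ?s mu i) = (\<Sum>i=1..m. lam i + mu i) + 2 * (\<Sum>i=1..m. m + 1 - i)"
        by (simp only: sum.distrib sum_shifted_parts)
      then show ?thesis by (simp add: power_add power_mult)
    qed
    then have "G x y = (\<Sum>lam\<in>?P. \<Sum>mu\<in>?P. ?t (?s lam) (?s mu))"
      by (simp add: G_alternants coef_def index_set_eq)
    also have "\<dots> = (\<Sum>lam\<in>?P. \<Sum>h\<in>dec_functions m n. ?t (?s lam) h)"
      by (intro sum.cong refl sum.reindex_bij_betw bij_betw_shifted_parts assms(4))
    also have "\<dots> = (\<Sum>f\<in>dec_functions m n. \<Sum>h\<in>dec_functions m n. ?t f h)"
      by (intro sum.reindex_bij_betw bij_betw_shifted_parts assms(4))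
    finally show ?thesis
      by (simp only: det_kernel_expansion[OF inv1 D D0 assms(4)])
  qed
  have "G \<in> antisym_tensor n m"
  proof (rule antisym_tensorI)
    show "G x y = (\<Sum>q\<in>?P \<times> ?P. (coef (fst q) (snd q) * alternant m (?s (fst q)) x) * alternant m (?s (snd q)) y)" for x y
      unfolding G_alternants sum.cartesian_product case_prod_unfold ..
  qed (auto simp: finite_box_partitions intro!: antisym_space_const_mult alternant_in_antisym_space s)
  moreover have "f x = multi_functional L m (\<lambda>y. f y * G x y)" if "f \<in> antisym_space n m" for f x
    unfolding G_det by (rule det_kernel_reproduces[OF assms(1) inv2 that])
  ultimately have G: "reproducing_kernel L n m G"
    unfolding reproducing_kernel_def by blast
  have K: "is_mpoly2 m K"
  proof -
    have "K = (\<lambda>x y. \<Sum>q\<in>?P \<times> ?P. (coef (fst q) (snd q) * schur m (fst q) x) * schur m (snd q) y)"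
      unfolding K_def sum.cartesian_product case_prod_unfold ..
    then show ?thesis
      using is_mpoly2_sum_products[of "?P \<times> ?P" m "\<lambda>q x. coef (fst q) (snd q) * schur m (fst q) x"
          "\<lambda>q. schur m (snd q)"]
      by (simp add: finite_box_partitions is_mpoly_mult is_mpoly_const is_mpoly_schur)
  qed
  have "CD_kernel L n m = K"
    unfolding CD_kernel_def
  proof (rule the_equality)
    show "is_mpoly2 m K \<and> reproducing_kernel L n m (\<lambda>x y. vandermonde m x * vandermonde m y * K x y)"
      using K G unfolding G_def by blast
    fix K'
    assume K': "is_mpoly2 m K' \<and> reproducing_kernel L n m (\<lambda>x y. vandermonde m x * vandermonde m y * K' x y)"
    have "(\<lambda>x y. vandermonde m x * vandermonde m y * K' x y) = G"
      using K' G by (intro reproducing_kernel_unique) auto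
    then show "K' = K"
      using K K' by (intro is_mpoly2_vandermonde_cancel[of m]) (auto simp: G_def fun_eq_iff)
  qed
  then show ?thesis by (simp add: K_def coef_def D_def)
qed

end
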